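(* Let $F$ be Thompson's group with standard generators $x_0, x_1$, and let $\mathcal{D}$ be the collection of all finite subsets of $[0,1]$ which contain $\{0,1\}$. Suppose that for every $\epsilon > 0$ there is a finite $\mathcal{A} \subseteq \mathcal{D}$ such that $$|\mathcal{A} \mathbin{\triangle} (\mathcal{A}\cdot x_i)| < \epsilon |\mathcal{A}|$$ for each $i < 2$ (that is, for $i = 0, 1$), and such that for every $X$ in $\mathcal{A}$, $\|X\| \leq 1/16$. Then $F$ is amenable.
   Context: $\mathcal{T}$ denotes the collection of all $T \in \mathcal{D}$ such that, if $t_i$ $(i \leq k)$ is the increasing enumeration of $T$, then for all $i<k$ there are non-negative integers $p$ and $q$ such that $t_i = p/2^q$ and $t_{i+1} = (p+1)/2^q$. If $(S,T)$ is a pair of elements of $\mathcal{T}$ of the same cardinality, the increasing bijection from $S$ to $T$ extends linearly on the complement of $S$ to a piecewise linear map $[0,1]\to[0,1]$; the pair $(S,T)$ is said to represent this map. Thompson's group $F$ is the collection of all such maps under composition. Its standard generators are the maps represented by $$x_0 = \left(\{0,\tfrac12,\tfrac34,1\},\{0,\tfrac14,\tfrac12,1\}\right), \qquad x_1 = \left(\{0,\tfrac12,\tfrac34,\tfrac78,1\},\{0,\tfrac12,\tfrac58,\tfrac34,1\}\right).$$ $F$ acts on $\mathcal{D}$ by taking images: for $f\in F$ and $X\in\mathcal{D}$, $f\cdot X = \{f(x) : x\in X\}$. For $\mathcal{A}\subseteq\mathcal{D}$, $\mathcal{A}\cdot x_i$ denotes the translate $\{x_i\cdot X : X\in\mathcal{A}\}$.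 For $X \in \mathcal{D}$, $\|X\|$ denotes the mesh of $X$, i.e. the maximum distance between consecutive elements of $X$. $\triangle$ denotes symmetric difference, and $|\cdot|$ denotes cardinality. Amenability of $F$ means amenability as a discrete group. *)

theory Defs
  imports Complex_Main "HOL-Algebra.Bij" "HOL-Algebra.Coset"
begin

section \<open>Finite subsets of the unit interval\<close>

definition unit_partitions :: "real set set" where
  "unit_partitions = {X. finite X \<and> X \<subseteq> {0..1} \<and> {0, 1} \<subseteq> X}"

definition consecutive :: "real set \<Rightarrow> real \<Rightarrow> real \<Rightarrow> bool" where
  "consecutive X a b \<longleftrightarrow> a \<in> X \<and> b \<in> X \<and> a < b \<and> {a<..<b} \<inter> X = {}"

definition mesh :: "real set \<Rightarrow> real" where
  "mesh X = Max {b - a | a b. consecutive X a b}"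

definition dyadic_partitions :: "real set set" where
  "dyadic_partitions = {T \<in> unit_partitions. \<forall>a b. consecutive T a b \<longrightarrow>
     (\<exists>p q :: nat. a = real p / 2 ^ q \<and> b = (real p + 1) / 2 ^ q)}"


section \<open>Thompson's group\<close>

text \<open>Self-maps of the unit interval are \<^const>\<open>extensional\<close> on \<open>{0..1}\<close>, as in
  \<^const>\<open>BijGroup\<close>, so that they are determined by their values there. On \<open>S\<close> itself,
  \<open>f\<close> is the increasing bijection from \<open>S\<close> to \<open>T\<close>.\<close>

definition represents :: "real set \<Rightarrow> real set \<Rightarrow> (real \<Rightarrow> real) \<Rightarrow> bool" where
  "represents S T f \<longleftrightarrow> f \<in> extensional {0..1} \<and> strict_mono_on S f \<and> f ` S = T \<and>
     (\<forall>a b. consecutive S a b \<longrightarrow>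
       (\<forall>u\<in>{0..1}. f ((1 - u) * a + u * b) = (1 - u) * f a + u * f b))"

lemma consecutive_interval:
  assumes "S \<in> unit_partitions" "x \<in> {0..1}" "x \<notin> S"
  obtains a b where "consecutive S a b" "a < x" "x < b"
proof -
  define a where "a = Max {s \<in> S. s \<le> x}"
  define b where "b = Min {s \<in> S. x \<le> s}"
  have fin: "finite {s \<in> S. s \<le> x}" "finite {s \<in> S. x \<le> s}"
    using assms by (auto simp: unit_partitions_def)
  have ne: "{s \<in> S. s \<le> x} \<noteq> {}" "{s \<in> S. x \<le> s} \<noteq> {}"
    using assms by (auto simp: unit_partitions_def)
  have a: "a \<in> S" "a \<le> x" using Max_in[OF fin(1) ne(1)] by (auto simp: a_def)
  have b: "b \<in> S" "x \<le> b" using Min_in[OF fin(2) ne(2)] by (auto simp: b_def)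
  have ab: "a < x" "x < b" using a b assms(3) by (auto simp: less_le)
  have "s \<le> a" if "s \<in> S" "s \<le> x" for s using Max_ge[OF fin(1)] that by (auto simp: a_def)
  moreover have "b \<le> s" if "s \<in> S" "x \<le> s" for s using Min_le[OF fin(2)] that by (auto simp: b_def)
  ultimately have "{a<..<b} \<inter> S = {}"
    by (metis disjoint_iff greaterThanLessThan_iff linear not_le)
  then show ?thesis using that a b ab by (auto simp: consecutive_def)
qed

lemma consecutive_unique:
  assumes "consecutive S a b" "a < x" "x < b" "consecutive S a' b'" "a' < x" "x < b'"
  shows "a' = a" "b' = b"
proof -
  have "a \<notin> {a'<..<b'}" "a' \<notin> {a<..<b}" "b \<notin> {a'<..<b'}" "b' \<notin> {a<..<b}"
    using assms unfolding consecutive_def by blast+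
  then show "a' = a" "b' = b" using assms by auto
qed

lemma represents_unique:
  assumes "S \<in> unit_partitions" "represents S T f" "represents S T g"
  shows "f = g"
proof
  fix x
  have finS: "finite S" using assms(1) by (simp add: unit_partitions_def)
  have *: "map h (sorted_list_of_set S) = sorted_list_of_set T" if "represents S T h" for h
  proof -
    have h: "strict_mono_on S h" "h ` S = T" using that by (auto simp: represents_def)
    have "sorted (map h (sorted_list_of_set S))"
      unfolding sorted_map
      by (rule sorted_wrt_mono_rel[OF _ sorted_sorted_list_of_set])
         (use h finS in \<open>auto dest: strict_mono_onD simp: le_less\<close>)
    moreover have "distinct (map h (sorted_list_of_set S))"
      using h finS strict_mono_on_imp_inj_on by (auto simp: distinct_map)
    ultimately have "sorted_list_of_set (set (map h (sorted_list_of_set S))) = map h (sorted_list_of_set S)"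
      by (metis sorted_list_of_set.idem_if_sorted_distinct)
    then show ?thesis using h finS by simp
  qed
  have eqS: "f s = g s" if "s \<in> S" for s
    using *[OF assms(2)] *[OF assms(3)] that finS by (metis map_eq_conv set_sorted_list_of_set)
  consider "x \<notin> {0..1}" | "x \<in> S" | "x \<in> {0..1}" "x \<notin> S" by blast
  then show "f x = g x"
  proof cases
    case 1
    then show ?thesis using assms(2,3) by (simp add: represents_def extensional_def)
  next
    case 2
    then show ?thesis by (rule eqS)
  next
    case 3
    then obtain a b where ab: "consecutive S a b" "a < x" "x < b"
      using consecutive_interval[OF assms(1)] by metis
    define u where "u = (x - a) / (b - a)"
    have u: "u \<in> {0..1}" using ab by (simp add: u_def field_simps)
    have "u * (b - a) = x - a" using ab by (simp add: u_def)
    then have x: "x = (1 - u) * a + u * b" by (simp add: algebra_simps)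
    have "f x = (1 - u) * f a + u * f b" "g x = (1 - u) * g a + u * g b"
      using assms(2,3) ab(1) u x by (auto simp: represents_def)
    then show ?thesis using eqS ab(1) by (simp add: consecutive_def)
  qed
qed

lemma finite_strict_mono_enum:
  fixes S :: "real set"
  assumes "finite S"
  shows "\<exists>k. bij_betw k {..<card S} S \<and> strict_mono_on {..<card S} k"
proof (intro exI conjI)
  let ?L = "sorted_list_of_set S"
  show "bij_betw (nth ?L) {..<card S} S"
    using assms by (intro bij_betw_nth) auto
  show "strict_mono_on {..<card S} (nth ?L)"
    using assms strict_sorted_list_of_set[of S]
    by (intro strict_mono_onI) (auto simp: sorted_wrt_iff_nth_less)
qed

lemma represents_exists:
  assumes "S \<in> unit_partitions" "T \<in> unit_partitions" "card S = card T"
  shows "\<exists>f. represents S T f"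
proof -
  have fin: "finite S" "finite T" using assms by (auto simp: unit_partitions_def)
  obtain k where k: "bij_betw k {..<card S} S" "strict_mono_on {..<card S} k"
    using finite_strict_mono_enum[OF fin(1)] by blast
  obtain l where l: "bij_betw l {..<card T} T" "strict_mono_on {..<card T} l"
    using finite_strict_mono_enum[OF fin(2)] by blast
  define \<beta> where "\<beta> = (\<lambda>s. l (inv_into {..<card S} k s))"
  have \<beta>k: "\<beta> (k i) = l i" if "i < card S" for i
    using k that by (simp add: \<beta>_def bij_betw_def)
  have S: "S = k ` {..<card S}" and T: "T = l ` {..<card S}"
    using k l assms(3) by (auto simp: bij_betw_def)
  have img: "\<beta> ` S = T"
    using \<beta>k by (subst S, subst T) (auto simp: image_iff)
  have mono: "strict_mono_on S \<beta>"
  proof (rule strict_mono_onI)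
    fix r s assume "r \<in> S" "s \<in> S" and rs: "r < s"
    then obtain i j where ij: "r = k i" "s = k j" "i < card S" "j < card S" using S by blast
    have "i < j"
    proof (rule ccontr)
      assume "\<not> i < j"
      then have "j < i \<or> j = i" by auto
      then have "k j \<le> k i" using k(2) ij by (auto dest: strict_mono_onD simp: le_less)
      then show False using rs ij by simp
    qed
    then show "\<beta> r < \<beta> s" using strict_mono_onD[OF l(2), of i j] ij \<beta>k assms(3) by simp
  qed
  define P where "P = (\<lambda>x (a, b). consecutive S a b \<and> a < x \<and> x < b)"
  define f where "f = (\<lambda>x\<in>{0..1}. if x \<in> S then \<beta> x else
     (let (a, b) = (SOME p. P x p) in \<beta> a + (x - a) / (b - a) * (\<beta> b - \<beta> a)))"
  have sub: "S \<subseteq> {0..1}" using assms by (auto simp: unit_partitions_def)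
  have fS: "f s = \<beta> s" if "s \<in> S" for s using that sub by (auto simp: f_def)
  have "f ((1 - u) * a + u * b) = (1 - u) * f a + u * f b"
    if c: "consecutive S a b" and u: "u \<in> {0..1}" for a b u
  proof (cases "u = 0 \<or> u = 1")
    case True
    then show ?thesis by auto
  next
    case False
    define x where "x = (1 - u) * a + u * b"
    have S: "a \<in> S" "b \<in> S" "a < b" using c by (auto simp: consecutive_def)
    have xa: "x - a = u * (b - a)" and xb: "b - x = (1 - u) * (b - a)"
      by (simp_all add: x_def algebra_simps)
    have "0 < x - a" "0 < b - x" unfolding xa xb using False u S by auto
    then have x: "a < x" "x < b" by auto
    then have "x \<notin> S" using c by (auto simp: consecutive_def)
    have "P x (a, b)" using c x by (simp add: P_def)
    moreover have "p = (a, b)" if "P x p" for p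
      using that consecutive_unique[OF c x] by (auto simp: P_def)
    ultimately have "(SOME p. P x p) = (a, b)" by (metis someI)
    moreover have "x \<in> {0..1}" using x S sub by fastforce
    ultimately have "f x = \<beta> a + (x - a) / (b - a) * (\<beta> b - \<beta> a)"
      using \<open>x \<notin> S\<close> by (simp add: f_def)
    also have "(x - a) / (b - a) = u" using S by (simp add: xa)
    finally show ?thesis using S by (simp add: fS x_def algebra_simps)
  qed
  moreover have "strict_mono_on S f" "f ` S = T"
    using mono img fS by (auto simp: strict_mono_on_def image_iff)
  ultimately have "represents S T f" by (auto simp: represents_def f_def)
  then show ?thesis by blast
qed

lemma ex1_represents:
  assumes "S \<in> unit_partitions" "T \<in> unit_partitions" "card S = card T"
  shows "\<exists>!f. represents S T f"
  using represents_exists[OF assms] represents_unique[OF assms(1)] by blast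

definition represented_map :: "real set \<Rightarrow> real set \<Rightarrow> real \<Rightarrow> real" where
  "represented_map S T = (THE f. represents S T f)"

lemma represents_represented_map:
  assumes "S \<in> unit_partitions" "T \<in> unit_partitions" "card S = card T"
  shows "represents S T (represented_map S T)"
  unfolding represented_map_def by (rule theI'[OF ex1_represents[OF assms]])

definition thompson_F :: "(real \<Rightarrow> real) monoid" where
  "thompson_F = (BijGroup {0..1})\<lparr>carrier :=
     {represented_map S T | S T.
        S \<in> dyadic_partitions \<and> T \<in> dyadic_partitions \<and> card S = card T}\<rparr>"

definition thompson_x0 :: "real \<Rightarrow> real" where
  "thompson_x0 = represented_map {0, 1/2, 3/4, 1} {0, 1/4, 1/2, 1}"

definition thompson_x1 :: "real \<Rightarrow> real" where
  "thompson_x1 = represented_map {0, 1/2, 3/4, 7/8, 1} {0, 1/2, 5/8, 3/4, 1}"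

definition translate :: "real set set \<Rightarrow> (real \<Rightarrow> real) \<Rightarrow> real set set" where
  "translate \<A> f = {f ` X | X. X \<in> \<A>}"


section \<open>Amenability of discrete groups\<close>

text \<open>A discrete group is amenable if all its subsets can be measured by a finitely additive
  probability measure that is invariant under left translation.\<close>

definition amenable :: "('a, 'b) monoid_scheme \<Rightarrow> bool" where
  "amenable G \<longleftrightarrow> group G \<and>
     (\<exists>\<mu> :: 'a set \<Rightarrow> real.
        (\<forall>A \<subseteq> carrier G. 0 \<le> \<mu> A) \<and>
        \<mu> (carrier G) = 1 \<and>
        (\<forall>A \<subseteq> carrier G. \<forall>B \<subseteq> carrier G. A \<inter> B = {} \<longrightarrow> \<mu> (A \<union> B) = \<mu> A + \<mu> B) \<and>
        (\<forall>g \<in> carrier G. \<forall>A \<subseteq> carrier G. \<mu> (g <#\<^bsub>G\<^esub> A) = \<mu> A))"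

end

theory Submission
  imports Defs "HOL-Algebra.Generated_Groups" "HOL-Analysis.Function_Topology"
begin

text \<open>Finite subsets of the unit interval have large stabilisers in \<open>F\<close>, so almost invariant sets of
them do not by themselves give almost invariant sets of group elements. The mesh bound makes it
possible to attach to every finite set \<open>X\<close> a group element \<open>frame X\<close> such that
\<open>frame (x\<^sub>i \<cdot> X) = x\<^sub>i \<cdot> frame X\<close> for both generators. The push-forward along \<open>frame\<close> of the uniform
measure on an almost invariant family is then a probability measure on \<open>F\<close> that each generator
almost preserves by left translation.

The element is found in two steps. Repeatedly halve the unit interval, and go on halving a half-open
dyadic interval as long as it contains two points of \<open>X\<close>; this produces a dyadic partition
\<open>adapted X\<close>. Take for \<open>frame X\<close> the map from the comb
\<open>{0, 1/2, 3/4, 7/8, \<dots>, 1}\<close> with equally many points to \<open>adapted X\<close>. If a map \<open>f\<close> is represented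
by dyadic partitions \<open>(S, T)\<close> and every interval of \<open>S\<close> contains two points of \<open>X\<close>, then the halving
process passes through \<open>S\<close> for \<open>X\<close> and through \<open>T\<close> for \<open>f \<cdot> X\<close>, and from there on the two processes
correspond under \<open>f\<close>, because \<open>f\<close> maps the dyadic subintervals of an interval of \<open>S\<close> to those of an
interval of \<open>T\<close>. Hence \<open>f \<cdot> adapted X = adapted (f \<cdot> X)\<close> (\<open>adapted_image\<close>), and
\<open>f \<circ> frame X\<close> and \<open>frame (f \<cdot> X)\<close> are represented by the same pair (\<open>frame_equivariant\<close>). The intervals
defining \<open>x\<^sub>0\<close> and \<open>x\<^sub>1\<close> have length at least \<open>1/8\<close>, so a mesh of at most \<open>1/16\<close> guarantees two points
in each of them.

It remains to pass from almost invariant measures to an invariant one. The cube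
\<open>[0,1]\<close> to the power of the set of all subsets of \<open>F\<close> is compact, so the measures for \<open>\<epsilon> \<rightarrow> 0\<close> have a
cluster point; it is finitely additive and exactly invariant under \<open>x\<^sub>0\<close> and \<open>x\<^sub>1\<close> (\<open>invariant_limit\<close>).
Invariance under all of \<open>F\<close> follows because \<open>x\<^sub>0\<close> and \<open>x\<^sub>1\<close> generate \<open>F\<close> (\<open>thompson_F_generated\<close>). This is
proved by building a dyadic partition \<open>T\<close> from \<open>{0, 1}\<close> one midpoint at a time: each new midpoint changes
the map from the comb to \<open>T\<close> by a factor \<open>x\<^sub>j\<close> or not at all, where \<open>x\<^sub>0, x\<^sub>1, x\<^sub>2, \<dots>\<close> is the usual infinite
generating sequence, in which every later element is a conjugate of \<open>x\<^sub>1\<close> by a power of \<open>x\<^sub>0\<close>.\<close>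

section \<open>Standard dyadic intervals\<close>

definition dyadic_interval :: "real \<Rightarrow> real \<Rightarrow> bool" where
  "dyadic_interval a b \<longleftrightarrow> (\<exists>p q :: nat. a = real p / 2 ^ q \<and> b = (real p + 1) / 2 ^ q)"

lemma dyadic_partitions_iff:
  "T \<in> dyadic_partitions \<longleftrightarrow>
     T \<in> unit_partitions \<and> (\<forall>a b. consecutive T a b \<longrightarrow> dyadic_interval a b)"
  by (simp add: dyadic_partitions_def dyadic_interval_def)

lemma dyadic_interval_less: "dyadic_interval a b \<Longrightarrow> a < b"
  by (auto simp: dyadic_interval_def divide_strict_right_mono)

lemma dyadic_interval_nonneg: "dyadic_interval a b \<Longrightarrow> 0 \<le> a"
  by (auto simp: dyadic_interval_def)

text \<open>Both intervals lie on the finer of the two dyadic grids, and there the overlap of the interiors becomes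
an inequality between integers, so the smaller interval is a grid cell of the larger one.\<close>

lemma dyadic_subinterval_coordinates:
  assumes "dyadic_interval a b" "dyadic_interval c d" "d - c \<le> b - a" "c < b" "a < d"
  obtains j e :: nat where "j < 2 ^ e" "c = a + (b - a) * (real j / 2 ^ e)"
    "d = a + (b - a) * ((real j + 1) / 2 ^ e)"
proof -
  obtain p q :: nat where a: "a = real p / 2 ^ q" "b = (real p + 1) / 2 ^ q"
    using assms by (auto simp: dyadic_interval_def)
  obtain r s :: nat where c: "c = real r / 2 ^ s" "d = (real r + 1) / 2 ^ s"
    using assms by (auto simp: dyadic_interval_def)
  have "b - a = 1 / 2 ^ q" "d - c = 1 / 2 ^ s"
    by (simp_all add: a c diff_divide_distrib [symmetric])
  then have "1 / 2 ^ s \<le> (1::real) / 2 ^ q" using assms(3) by simp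
  then have "(2::real) ^ q \<le> 2 ^ s" by (simp add: field_simps del: power_increasing_iff)
  then have "q \<le> s" by simp
  then obtain e where s: "s = q + e" using le_Suc_ex by blast
  have "real r < (real p + 1) * 2 ^ e"
    using \<open>c < b\<close> by (simp add: a c s power_add field_simps)
  then have "real r < real ((p + 1) * 2 ^ e)" by (simp add: algebra_simps)
  then have r1: "r < (p + 1) * 2 ^ e" by (simp only: of_nat_less_iff)
  have "real p * 2 ^ e < real r + 1"
    using \<open>a < d\<close> by (simp add: a c s power_add field_simps)
  then have "real (p * 2 ^ e) < real (r + 1)" by simp
  then have r2: "p * 2 ^ e \<le> r" by (simp only: of_nat_less_iff)
  define j where "j = r - p * 2 ^ e"
  have j: "real j = real r - real p * 2 ^ e" using r2 by (simp add: j_def of_nat_diff)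
  have "c = a + (b - a) * (real j / 2 ^ e)" "d = a + (b - a) * ((real j + 1) / 2 ^ e)"
    by (simp_all add: j a c s power_add field_simps)
  moreover have "j < 2 ^ e" using r1 r2 by (simp add: j_def algebra_simps)
  ultimately show thesis using that by blast
qed

lemma dyadic_interval_subdivide:
  assumes "dyadic_interval a b"
  shows "dyadic_interval (a + (b - a) * (real j / 2 ^ e)) (a + (b - a) * ((real j + 1) / 2 ^ e))"
proof -
  obtain p q :: nat where a: "a = real p / 2 ^ q" "b = (real p + 1) / 2 ^ q"
    using assms by (auto simp: dyadic_interval_def)
  have "a + (b - a) * (real j / 2 ^ e) = real (p * 2 ^ e + j) / 2 ^ (q + e)"
    "a + (b - a) * ((real j + 1) / 2 ^ e) = (real (p * 2 ^ e + j) + 1) / 2 ^ (q + e)"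
    by (simp_all add: a power_add field_simps)
  then show ?thesis unfolding dyadic_interval_def by blast
qed

lemma dyadic_interval_halves:
  assumes "dyadic_interval a b"
  shows "dyadic_interval a ((a + b) / 2)" "dyadic_interval ((a + b) / 2) b"
  using dyadic_interval_subdivide[OF assms, of 0 1] dyadic_interval_subdivide[OF assms, of 1 1]
  by (simp_all add: field_simps)

lemma dyadic_interval_nested:
  assumes "dyadic_interval a b" "dyadic_interval c d" "d - c \<le> b - a" "c < b" "a < d"
  shows "a \<le> c" "d \<le> b"
proof -
  obtain j e :: nat where j: "j < 2 ^ e" "c = a + (b - a) * (real j / 2 ^ e)"
    "d = a + (b - a) * ((real j + 1) / 2 ^ e)"
    using dyadic_subinterval_coordinates[OF assms] by blast
  have ab: "0 \<le> b - a" using dyadic_interval_less[OF assms(1)] by simp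
  then show "a \<le> c" by (simp add: j)
  have "real (j + 1) \<le> real (2 ^ e)" using j(1) by (simp only: of_nat_le_iff)
  then have "(real j + 1) / 2 ^ e \<le> 1" by simp
  then have "(b - a) * ((real j + 1) / 2 ^ e) \<le> b - a" using ab by (rule mult_left_le)
  then show "d \<le> b" by (simp add: j)
qed

text \<open>Nestedness leaves the possibility that \<open>[a, b]\<close> is properly contained in \<open>[c, d]\<close>; then it lies in one of
the two halves, and the midpoint is not interior to it. This is why the midpoints of dyadic intervals
inside \<open>[a, b]\<close> are exactly those that fall into its interior.\<close>

lemma dyadic_interval_midpoint_inside:
  assumes ab: "dyadic_interval a b" and cd: "dyadic_interval c d"
    and m: "a < (c + d) / 2" "(c + d) / 2 < b"
  shows "a \<le> c" "d \<le> b"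
proof -
  let ?m = "(c + d) / 2"
  have cm: "c < ?m" "?m < d" using dyadic_interval_less[OF cd] by auto
  have "a \<le> c \<and> d \<le> b"
  proof (cases "?m - c \<le> b - a")
    case True
    then have "d - ?m \<le> b - a" by argo
    then show ?thesis
      using dyadic_interval_nested[OF ab dyadic_interval_halves(1)[OF cd]]
        dyadic_interval_nested[OF ab dyadic_interval_halves(2)[OF cd]] True m cm by argo
  next
    case False
    then have "b \<le> ?m"
      using dyadic_interval_nested[OF dyadic_interval_halves(1)[OF cd] ab] m cm by argo
    then show ?thesis using m by argo
  qed
  then show "a \<le> c" "d \<le> b" by auto
qed

lemma dyadic_interval_affine_image:
  assumes "dyadic_interval a b" "dyadic_interval a' b'" "dyadic_interval c d" "a \<le> c" "d \<le> b"
    and h: "\<And>u. u \<in> {0..1} \<Longrightarrow> h ((1 - u) * a + u * b) = (1 - u) * a' + u * b'"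
  shows "dyadic_interval (h c) (h d)"
proof -
  have *: "d - c \<le> b - a" "c < b" "a < d"
    using assms dyadic_interval_less[OF assms(3)] by auto
  obtain j e :: nat where j: "j < 2 ^ e" "c = a + (b - a) * (real j / 2 ^ e)"
    "d = a + (b - a) * ((real j + 1) / 2 ^ e)"
    using dyadic_subinterval_coordinates[OF assms(1,3) *] by blast
  have "real (j + 1) \<le> real (2 ^ e)" using j(1) by (simp only: of_nat_le_iff)
  then have le: "(real j + 1) / 2 ^ e \<in> {0..1}" by simp
  have le': "real j / 2 ^ e \<in> {0..1}" using j(1) by simp
  have h': "h (a + (b - a) * u) = a' + (b' - a') * u" if "u \<in> {0..1}" for u
    using h[OF that] by (simp add: algebra_simps)
  have "h c = a' + (b' - a') * (real j / 2 ^ e)" "h d = a' + (b' - a') * ((real j + 1) / 2 ^ e)"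
    using h'[OF le] h'[OF le'] unfolding j by simp_all
  then show ?thesis using dyadic_interval_subdivide[OF assms(2)] by simp
qed

text \<open>A dyadic point strictly between 0 and 1 is the midpoint of exactly one dyadic interval, found by cancelling factors of two from
the numerator. Each cancellation replaces an interval with left end \<open>s\<close> by one that is twice as
long and still has left end \<open>s\<close>, so the interval found at the end contains \<open>[s, t]\<close>.\<close>

lemma dyadic_left_endpoint_is_midpoint:
  assumes "dyadic_interval s t" "0 < s" "t \<le> 1"
  obtains c d where "dyadic_interval c d" "s = (c + d) / 2" "t \<le> d" "d \<le> 1"
proof -
  have "\<exists>c d. dyadic_interval c d \<and> real p / 2 ^ q = (c + d) / 2 \<and> (real p + 1) / 2 ^ q \<le> d \<and> d \<le> 1"
    if "0 < p" "(real p + 1) / 2 ^ q \<le> 1" for p q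
    using that
  proof (induction q arbitrary: p)
    case 0
    then show ?case by simp
  next
    case (Suc q)
    show ?case
    proof (cases "even p")
      case True
      then obtain k where k: "p = 2 * k" by auto
      have "real (2 * k + 1) \<le> real (2 * 2 ^ q)" using Suc.prems(2) by (simp add: k)
      then have "2 * k + 1 \<le> 2 * 2 ^ q" by (simp only: of_nat_le_iff)
      then have "k + 1 \<le> 2 ^ q" by linarith
      then have "real (k + 1) \<le> real (2 ^ q)" by (simp only: of_nat_le_iff)
      then have "(real k + 1) / 2 ^ q \<le> 1" by simp
      then obtain c d where cd: "dyadic_interval c d" "real k / 2 ^ q = (c + d) / 2"
        "(real k + 1) / 2 ^ q \<le> d" "d \<le> 1"
        using Suc.IH[of k] Suc.prems(1) k by auto
      have "real p / 2 ^ Suc q = real k / 2 ^ q" by (simp add: k)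
      moreover have "(real p + 1) / 2 ^ Suc q \<le> (real k + 1) / 2 ^ q"
        by (simp add: k field_simps)
      ultimately show ?thesis using cd by (metis order_trans)
    next
      case False
      then obtain k where k: "p = 2 * k + 1" by (elim oddE)
      have "dyadic_interval (real k / 2 ^ q) ((real k + 1) / 2 ^ q)"
        by (auto simp: dyadic_interval_def)
      moreover have "(real p + 1) / 2 ^ Suc q = (real k + 1) / 2 ^ q"
        by (simp add: k field_simps)
      moreover have "real p / 2 ^ Suc q = (real k / 2 ^ q + (real k + 1) / 2 ^ q) / 2"
        by (simp add: k field_simps)
      ultimately show ?thesis using Suc.prems(2) by (metis order_refl)
    qed
  qed
  then show thesis using assms that unfolding dyadic_interval_def
    by (metis of_nat_0_less_iff zero_less_divide_iff of_nat_less_0_iff)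
qed

section \<open>Consecutive points\<close>

lemma unit_partitionsD:
  assumes "X \<in> unit_partitions"
  shows "finite X" "X \<subseteq> {0..1}" "0 \<in> X" "1 \<in> X"
  using assms by (auto simp: unit_partitions_def)

lemma consecutiveD:
  assumes "consecutive X a b"
  shows "a \<in> X" "b \<in> X" "a < b" "\<And>x. x \<in> X \<Longrightarrow> x \<le> a \<or> b \<le> x"
  using assms by (auto simp: consecutive_def not_le)

lemma consecutiveI:
  assumes "a \<in> X" "b \<in> X" "a < b" "\<And>x. x \<in> X \<Longrightarrow> x \<le> a \<or> b \<le> x"
  shows "consecutive X a b"
  using assms unfolding consecutive_def by (force simp: not_le[symmetric])

text \<open>The two covering lemmas differ in which end of the gap may coincide with \<open>x\<close>; the half-open form is
what selects the gap on the left or on the right of a point of \<open>X\<close>.\<close>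

lemma consecutive_around:
  assumes "X \<in> unit_partitions" "0 < x" "x \<le> 1"
  obtains a b where "consecutive X a b" "a < x" "x \<le> b"
proof (cases "x \<in> X")
  case False
  then show ?thesis
    using consecutive_interval[OF assms(1), of x] assms that by (metis atLeastAtMost_iff less_le)
next
  case True
  let ?A = "{s \<in> X. s < x}"
  have fin: "finite ?A" and ne: "?A \<noteq> {}" using unit_partitionsD[OF assms(1)] assms by auto
  have "Max ?A \<in> ?A" using Max_in[OF fin ne] .
  moreover have "s \<le> Max ?A" if "s \<in> X" "s < x" for s using Max_ge[OF fin] that by auto
  ultimately have "consecutive X (Max ?A) x" using True by (auto intro!: consecutiveI simp: not_le[symmetric])
  then show ?thesis using that \<open>Max ?A \<in> ?A\<close> by auto
qed

lemma consecutive_around':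
  assumes "X \<in> unit_partitions" "0 \<le> x" "x < 1"
  obtains a b where "consecutive X a b" "a \<le> x" "x < b"
proof (cases "x \<in> X")
  case False
  then show ?thesis
    using consecutive_interval[OF assms(1), of x] assms that by (metis atLeastAtMost_iff less_le)
next
  case True
  let ?A = "{s \<in> X. x < s}"
  have fin: "finite ?A" and ne: "?A \<noteq> {}" using unit_partitionsD[OF assms(1)] assms by auto
  have "Min ?A \<in> ?A" using Min_in[OF fin ne] .
  moreover have "Min ?A \<le> s" if "s \<in> X" "x < s" for s using Min_le[OF fin] that by auto
  ultimately have "consecutive X x (Min ?A)" using True by (auto intro!: consecutiveI simp: not_le[symmetric])
  then show ?thesis using that \<open>Min ?A \<in> ?A\<close> by auto
qed

lemma consecutive_unit:
  assumes "X \<in> unit_partitions" "consecutive X a b"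
  shows "0 \<le> a" "a < b" "b \<le> 1"
  using unit_partitionsD(2)[OF assms(1)] consecutiveD[OF assms(2)] by auto

lemma consecutive_refine:
  assumes "S \<in> unit_partitions" "S \<subseteq> U" "U \<subseteq> {0..1}" "consecutive U a b"
  obtains c d where "consecutive S c d" "c \<le> a" "b \<le> d"
proof -
  have "a \<in> U" "b \<in> U" "a < b" "\<And>x. x \<in> U \<Longrightarrow> x \<le> a \<or> b \<le> x" using consecutiveD[OF assms(4)] by auto
  moreover from this have "0 \<le> a" "a < 1" using assms(3) by auto
  then obtain c d where "consecutive S c d" "c \<le> a" "a < d" using consecutive_around'[OF assms(1)] by blast
  moreover from this have "d \<in> U" using assms(2) consecutiveD(2) by blast
  ultimately show ?thesis using that by fastforce
qed

lemma consecutive_image: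
  assumes "strict_mono_on X f" "consecutive X a b"
  shows "consecutive (f ` X) (f a) (f b)"
proof (rule consecutiveI)
  note ab = consecutiveD[OF assms(2)]
  show "f a \<in> f ` X" "f b \<in> f ` X" using ab by auto
  show "f a < f b" using ab assms(1) by (auto dest: strict_mono_onD)
  show "y \<le> f a \<or> f b \<le> y" if y: "y \<in> f ` X" for y
  proof -
    obtain x where x: "x \<in> X" "y = f x" using y by blast
    then show ?thesis
      using ab strict_mono_on_leD[OF assms(1), of x a] strict_mono_on_leD[OF assms(1), of b x] by blast
  qed
qed

lemma consecutive_image_iff:
  assumes "strict_mono_on X f"
  shows "consecutive (f ` X) y z \<longleftrightarrow> (\<exists>a b. consecutive X a b \<and> y = f a \<and> z = f b)"
proof
  assume c: "consecutive (f ` X) y z"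
  obtain a b where ab: "a \<in> X" "b \<in> X" "y = f a" "z = f b" using consecutiveD[OF c] by blast
  have le: "f s \<le> f t \<longleftrightarrow> s \<le> t" "f s < f t \<longleftrightarrow> s < t" if "s \<in> X" "t \<in> X" for s t
    using assms that strict_mono_on_less_eq[OF assms] strict_mono_on_less[OF assms] by auto
  have "consecutive X a b"
  proof (rule consecutiveI)
    show "a < b" using consecutiveD(3)[OF c] ab le by simp
    show "x \<le> a \<or> b \<le> x" if "x \<in> X" for x
      using consecutiveD(4)[OF c, of "f x"] that ab le by simp
  qed (use ab in auto)
  then show "\<exists>a b. consecutive X a b \<and> y = f a \<and> z = f b" using ab by blast
qed (use consecutive_image[OF assms] in auto)

section \<open>Piecewise affine maps\<close>

lemma representsD:
  assumes "represents S T f"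
  shows "f \<in> extensional {0..1}" "strict_mono_on S f" "f ` S = T"
    "\<And>a b u. consecutive S a b \<Longrightarrow> u \<in> {0..1} \<Longrightarrow> f ((1 - u) * a + u * b) = (1 - u) * f a + u * f b"
  using assms by (auto simp: represents_def)

lemma represents_card: "represents S T f \<Longrightarrow> card S = card T"
  using card_image strict_mono_on_imp_inj_on by (metis representsD(2,3))

lemma convex_coordinate:
  fixes a b x :: real
  assumes "a \<le> x" "x \<le> b" "a < b"
  obtains u where "u \<in> {0..1}" "x = (1 - u) * a + u * b"
proof
  define u where "u = (x - a) / (b - a)"
  show "(x - a) / (b - a) \<in> {0..1}" using assms by (simp add: field_simps)
  have "u * (b - a) = x - a" using assms by (simp add: u_def)
  then show "x = (1 - (x - a) / (b - a)) * a + (x - a) / (b - a) * b"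
    unfolding u_def[symmetric] by (simp add: algebra_simps)
qed

lemma represents_affine:
  assumes "represents S T f" "consecutive S a b"
  shows "\<exists>\<alpha> \<beta>. 0 < \<alpha> \<and> (\<forall>x\<in>{a..b}. f x = \<alpha> * x + \<beta>)"
proof (intro exI conjI ballI)
  define \<alpha> where "\<alpha> = (f b - f a) / (b - a)"
  have ab: "a < b" "f a < f b"
    using consecutiveD[OF assms(2)] representsD(2)[OF assms(1)] by (auto dest: strict_mono_onD)
  show "0 < (f b - f a) / (b - a)" using ab by simp
  fix x assume "x \<in> {a..b}"
  then have x: "a \<le> x" "x \<le> b" by auto
  obtain u where u: "u \<in> {0..1}" "x = (1 - u) * a + u * b" using convex_coordinate[OF x ab(1)] .
  have "\<alpha> * (b - a) = f b - f a" using ab by (simp add: \<alpha>_def)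
  moreover have "\<alpha> * x = \<alpha> * a + u * (\<alpha> * (b - a))"
    unfolding u(2) by (simp add: algebra_simps)
  moreover have "f x = (1 - u) * f a + u * f b"
    using representsD(4)[OF assms u(1)] u(2) by simp
  then have "f x = f a + u * (f b - f a)" by (simp add: algebra_simps)
  ultimately show "f x = (f b - f a) / (b - a) * x + (f a - (f b - f a) / (b - a) * a)"
    unfolding \<alpha>_def[symmetric] by simp
qed

lemma affine_convex_combination:
  fixes f :: "real \<Rightarrow> real"
  assumes "\<And>x. a \<le> x \<Longrightarrow> x \<le> b \<Longrightarrow> f x = \<alpha> * x + \<beta>" "a \<le> b" "u \<in> {0..1}"
  shows "f ((1 - u) * a + u * b) = (1 - u) * f a + u * f b"
proof -
  have "0 \<le> u * (b - a)" "0 \<le> (1 - u) * (b - a)" using assms by auto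
  then have "a \<le> (1 - u) * a + u * b" "(1 - u) * a + u * b \<le> b" by (simp_all add: algebra_simps)
  then have "f ((1 - u) * a + u * b) = \<alpha> * ((1 - u) * a + u * b) + \<beta>" by (rule assms(1))
  then show ?thesis using assms(1)[of a] assms(1)[of b] assms(2) by (simp add: algebra_simps)
qed

text \<open>Two points are compared through the ends of the pieces that contain them: either both lie on one
affine piece, or a point of \<open>S\<close> separates them.\<close>

lemma represents_strict_mono:
  assumes S: "S \<in> unit_partitions" and f: "represents S T f"
  shows "strict_mono_on {0..1} f"
proof (rule strict_mono_onI)
  have mono: "f s \<le> f t" if "s \<in> S" "t \<in> S" "s \<le> t" for s t
    using that strict_mono_on_leD[OF representsD(2)[OF f]] by blast
  have piece: "f x < f y" if xy: "consecutive S a b" "a \<le> x" "x < y" "y \<le> b" for a b x y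
  proof -
    obtain \<alpha> \<beta> where "0 < \<alpha>" and aff: "\<forall>x\<in>{a..b}. f x = \<alpha> * x + \<beta>"
      using represents_affine[OF f xy(1)] by blast
    have "f x = \<alpha> * x + \<beta>" "f y = \<alpha> * y + \<beta>" using aff xy by auto
    then show ?thesis using \<open>0 < \<alpha>\<close> xy by simp
  qed
  fix x y :: real assume xy: "x \<in> {0..1}" "y \<in> {0..1}" "x < y"
  obtain a b where ab: "consecutive S a b" "a \<le> x" "x < b"
    using consecutive_around'[OF S, of x] xy by auto
  obtain c d where cd: "consecutive S c d" "c < y" "y \<le> d"
    using consecutive_around[OF S, of y] xy by auto
  show "f x < f y"
  proof (cases "y \<le> b")
    case True
    then show ?thesis using piece ab xy by blast
  next
    case False
    have "b \<le> c" using consecutiveD(4)[OF cd(1) consecutiveD(2)[OF ab(1)]] False cd by auto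
    then have "f b \<le> f c" using mono consecutiveD[OF ab(1)] consecutiveD[OF cd(1)] by blast
    moreover have "f x < f b" using piece[OF ab] by simp
    moreover have "f c < f y" using piece[OF cd(1)] cd by simp
    ultimately show ?thesis by simp
  qed
qed

lemma represents_range:
  assumes S: "S \<in> unit_partitions" and T: "T \<in> unit_partitions" and f: "represents S T f"
  shows "f 0 = 0" "f 1 = 1" "x \<in> {0..1} \<Longrightarrow> f x \<in> {0..1}"
proof -
  note mono = strict_mono_on_leD[OF represents_strict_mono[OF S f]]
  have sub: "f s \<in> {0..1}" if "s \<in> S" for s
    using that unit_partitionsD(2)[OF T] representsD(3)[OF f] by blast
  obtain s where s: "s \<in> S" "f s = 0" using unit_partitionsD(3)[OF T] representsD(3)[OF f] by (metis imageE)
  obtain t where t: "t \<in> S" "f t = 1" using unit_partitionsD(4)[OF T] representsD(3)[OF f] by (metis imageE)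
  have st: "s \<in> {0..1}" "t \<in> {0..1}" using s t unit_partitionsD(2)[OF S] by auto
  have "f 0 \<le> 0" using mono[of 0 s] s st by auto
  then show 0: "f 0 = 0" using sub[OF unit_partitionsD(3)[OF S]] by auto
  have "1 \<le> f 1" using mono[of t 1] t st by auto
  then show 1: "f 1 = 1" using sub[OF unit_partitionsD(4)[OF S]] by auto
  show "f x \<in> {0..1}" if "x \<in> {0..1}" using mono[of 0 x] mono[of x 1] that 0 1 by auto
qed

lemma represents_refine:
  assumes S: "S \<in> unit_partitions" and f: "represents S T f" and U: "S \<subseteq> U" "U \<subseteq> {0..1}"
  shows "represents U (f ` U) f"
  unfolding represents_def
proof (intro conjI allI impI ballI)
  show "f \<in> extensional {0..1}" using representsD(1)[OF f] .
  show "strict_mono_on U f"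
    using monotone_on_subset[OF represents_strict_mono[OF S f] U(2)] .
  fix a b u assume ab: "consecutive U a b" and u: "u \<in> {0..1::real}"
  obtain c d where cd: "consecutive S c d" "c \<le> a" "b \<le> d"
    using consecutive_refine[OF S U ab] .
  obtain \<alpha> \<beta> where "0 < \<alpha>" "\<forall>x\<in>{c..d}. f x = \<alpha> * x + \<beta>"
    using represents_affine[OF f cd(1)] by blast
  then show "f ((1 - u) * a + u * b) = (1 - u) * f a + u * f b"
    using cd consecutiveD(3)[OF ab] u by (intro affine_convex_combination) auto
qed simp

lemma represents_compose:
  assumes f: "represents S T f" and g: "represents T U g" and S: "S \<subseteq> {0..1}"
  shows "represents S U (compose {0..1} g f)"
  unfolding represents_def
proof (intro conjI allI impI ballI)
  have eq: "compose {0..1} g f x = g (f x)" if "x \<in> S" for x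
    using that S by (auto simp: compose_def)
  show "compose {0..1} g f \<in> extensional {0..1}" by simp
  show "strict_mono_on S (compose {0..1} g f)"
    using representsD(2)[OF f] representsD(2)[OF g] representsD(3)[OF f] eq
    by (auto simp: strict_mono_on_def)
  show "compose {0..1} g f ` S = U"
    using eq representsD(3)[OF f] representsD(3)[OF g] by (auto simp: image_iff)
  fix a b u assume ab: "consecutive S a b" and u: "u \<in> {0..1::real}"
  have "a \<in> S" "b \<in> S" "a < b" using consecutiveD[OF ab] by auto
  moreover have "0 \<le> u * (b - a)" "0 \<le> (1 - u) * (b - a)" using u \<open>a < b\<close> by auto
  then have "a \<le> (1 - u) * a + u * b" "(1 - u) * a + u * b \<le> b" by (simp_all add: algebra_simps)
  ultimately have x: "(1 - u) * a + u * b \<in> {0..1}" using S by fastforce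
  have "consecutive T (f a) (f b)"
    using consecutive_image[OF representsD(2)[OF f] ab] representsD(3)[OF f] by simp
  then have "g ((1 - u) * f a + u * f b) = (1 - u) * g (f a) + u * g (f b)"
    using u by (rule representsD(4)[OF g])
  then show "compose {0..1} g f ((1 - u) * a + u * b)
      = (1 - u) * compose {0..1} g f a + u * compose {0..1} g f b"
    using representsD(4)[OF f ab u] x eq \<open>a \<in> S\<close> \<open>b \<in> S\<close> by (simp add: compose_def)
qed

lemma represents_identity:
  assumes "S \<subseteq> {0..1}"
  shows "represents S S (\<lambda>x\<in>{0..1}. x)"
  unfolding represents_def
proof (intro conjI allI impI ballI)
  show "strict_mono_on S (\<lambda>x\<in>{0..1}. x)" using assms by (auto simp: strict_mono_on_def)
  show "(\<lambda>x\<in>{0..1}. x) ` S = S" using assms by (auto simp: image_iff)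
  fix a b u assume ab: "consecutive S a b" and u: "u \<in> {0..1::real}"
  have "a \<in> {0..1}" "b \<in> {0..1}" "a < b" using consecutiveD[OF ab] assms by auto
  then show "(\<lambda>x\<in>{0..1}. x) ((1 - u) * a + u * b) = (1 - u) * (\<lambda>x\<in>{0..1}. x) a + u * (\<lambda>x\<in>{0..1}. x) b"
    using u by (intro affine_convex_combination[where \<alpha> = 1 and \<beta> = 0]) auto
qed simp

lemma represented_map_eqI:
  assumes "S \<in> unit_partitions" "represents S T f"
  shows "represented_map S T = f"
  unfolding represented_map_def
  using assms represents_unique[OF assms(1)] by blast

text \<open>The inverse is the map represented by the pair in the opposite order: both composites are represented
by a pair of equal partitions, and so is the identity.\<close>

lemma represents_inverse:
  assumes S: "S \<in> unit_partitions" and T: "T \<in> unit_partitions" and f: "represents S T f"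
  obtains g where "represents T S g" "\<forall>x\<in>{0..1}. g (f x) = x"
    "\<forall>y\<in>{0..1}. f (g y) = y"
proof -
  obtain g where g: "represents T S g"
    using represents_exists[OF T S] represents_card[OF f] by auto
  note sub = unit_partitionsD(2)[OF S] unit_partitionsD(2)[OF T]
  have gf: "compose {0..1} g f = (\<lambda>x\<in>{0..1}. x)"
    by (rule represents_unique[OF S represents_compose[OF f g sub(1)] represents_identity[OF sub(1)]])
  have fg: "compose {0..1} f g = (\<lambda>x\<in>{0..1}. x)"
    by (rule represents_unique[OF T represents_compose[OF g f sub(2)] represents_identity[OF sub(2)]])
  show thesis
  proof (rule that[OF g]; rule ballI)
    show "g (f x) = x" if "x \<in> {0..1}" for x
      using fun_cong[OF gf, of x] that by (simp add: compose_def)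
    show "f (g y) = y" if "y \<in> {0..1}" for y
      using fun_cong[OF fg, of y] that by (simp add: compose_def)
  qed
qed

text \<open>Read with \<open>f\<close> as the known map, this turns a representation of \<open>f\<close> into one of any right inverse of it;
in the closure of \<open>F\<close> under composition it transports a refined representation back to the original map.\<close>

lemma represents_inverse_function:
  assumes S: "S \<in> unit_partitions" and T: "T \<in> unit_partitions" and f: "represents S T f"
    and g: "g \<in> extensional {0..1}" "\<And>y. y \<in> {0..1} \<Longrightarrow> g y \<in> {0..1}" "\<And>y. y \<in> {0..1} \<Longrightarrow> f (g y) = y"
  shows "represents T S g"
proof -
  obtain h where h: "represents T S h" "\<forall>x\<in>{0..1}. h (f x) = x"
    by (rule represents_inverse[OF S T f])
  have "h = g"
  proof (rule extensionalityI[OF representsD(1)[OF h(1)] g(1)])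
    show "h y = g y" if "y \<in> {0..1}" for y using h(2)[rule_format, OF g(2)[OF that]] g(3)[OF that] by simp
  qed
  then show ?thesis using h by simp
qed

lemma represents_Bij:
  assumes S: "S \<in> unit_partitions" and T: "T \<in> unit_partitions" and f: "represents S T f"
  shows "f \<in> Bij {0..1}"
proof -
  obtain g where g: "represents T S g" "\<forall>x\<in>{0..1}. g (f x) = x"
    "\<forall>y\<in>{0..1}. f (g y) = y"
    by (rule represents_inverse[OF S T f])
  have "bij_betw f {0..1} {0..1}"
    using g represents_range(3)[OF S T f] represents_range(3)[OF T S g(1)]
    by (intro bij_betw_byWitness[where f' = g]) auto
  then show ?thesis using representsD(1)[OF f] by (simp add: Bij_def)
qed

lemma image_unit_partition:
  assumes S: "S \<in> unit_partitions" and T: "T \<in> unit_partitions" and f: "represents S T f"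
    and X: "X \<in> unit_partitions"
  shows "f ` X \<in> unit_partitions"
proof -
  note X' = unit_partitionsD[OF X]
  have "f ` X \<subseteq> {0..1}" using X'(2) represents_range(3)[OF S T f] by blast
  moreover have "0 \<in> f ` X" "1 \<in> f ` X"
    using X'(3,4) represents_range(1,2)[OF S T f] by (metis imageI)+
  ultimately show ?thesis using X'(1) by (simp add: unit_partitions_def)
qed

section \<open>Dyadic partitions\<close>

lemma dyadic_partitionsD:
  assumes "T \<in> dyadic_partitions"
  shows "T \<in> unit_partitions" "\<And>a b. consecutive T a b \<Longrightarrow> dyadic_interval a b"
  using assms by (auto simp: dyadic_partitions_iff)

text \<open>A gap of the union lies in a gap of \<open>S\<close> and a gap of \<open>T\<close>. These are nested dyadic intervals, so no point of
the union is interior to the smaller one, which therefore is the gap of the union.\<close>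

lemma dyadic_partition_union:
  assumes S: "S \<in> dyadic_partitions" and T: "T \<in> dyadic_partitions"
  shows "S \<union> T \<in> dyadic_partitions"
proof -
  note SD = dyadic_partitionsD[OF S] and TD = dyadic_partitionsD[OF T]
  have U: "S \<union> T \<in> unit_partitions" using SD(1) TD(1) by (auto simp: unit_partitions_def)
  have "dyadic_interval a b" if ab: "consecutive (S \<union> T) a b" for a b
  proof -
    note abD = consecutiveD[OF ab]
    obtain c d where cd: "consecutive S c d" "c \<le> a" "b \<le> d"
      using consecutive_refine[OF SD(1) _ unit_partitionsD(2)[OF U] ab] by blast
    obtain c' d' where cd': "consecutive T c' d'" "c' \<le> a" "b \<le> d'"
      using consecutive_refine[OF TD(1) _ unit_partitionsD(2)[OF U] ab] by blast
    note dy = SD(2)[OF cd(1)] TD(2)[OF cd'(1)]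
    have l: "x \<le> c \<or> d \<le> x \<or> x \<le> c' \<or> d' \<le> x" if "x \<in> S \<union> T" for x
      using that consecutiveD(4)[OF cd(1)] consecutiveD(4)[OF cd'(1)] by blast
    note la = l[OF abD(1)] and lb = l[OF abD(2)]
    consider "d' - c' \<le> d - c" | "d - c \<le> d' - c'" by linarith
    then show ?thesis
    proof cases
      case 1
      have "c \<le> c'" "d' \<le> d" using dyadic_interval_nested[OF dy 1] cd cd' abD(3) by auto
      then have "a = c'" "b = d'"
        using la lb abD(3) cd(2,3) cd'(2,3) by argo+
      then show ?thesis using dy by simp
    next
      case 2
      have "c' \<le> c" "d \<le> d'" using dyadic_interval_nested[OF dy(2,1) 2] cd cd' abD(3) by auto
      then have "a = c" "b = d"
        using la lb abD(3) cd(2,3) cd'(2,3) by argo+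
      then show ?thesis using dy by simp
    qed
  qed
  then show ?thesis using U by (simp add: dyadic_partitions_iff)
qed

lemma represents_dyadic_interval:
  assumes S: "S \<in> dyadic_partitions" and T: "T \<in> dyadic_partitions" and f: "represents S T f"
    and ab: "consecutive S a b" and cd: "dyadic_interval c d" "a \<le> c" "d \<le> b"
  shows "dyadic_interval (f c) (f d)"
proof -
  have "consecutive T (f a) (f b)"
    using consecutive_image[OF representsD(2)[OF f] ab] representsD(3)[OF f] by simp
  then show ?thesis
    using dyadic_interval_affine_image[OF dyadic_partitionsD(2)[OF S ab] dyadic_partitionsD(2)[OF T] cd]
      representsD(4)[OF f ab] by blast
qed

text \<open>Dyadic representations may be refined at will: on each interval of \<open>S\<close> the map is the affine bijection
between two dyadic intervals, and these carry dyadic subintervals to dyadic subintervals.\<close>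

lemma image_dyadic_refinement:
  assumes S: "S \<in> dyadic_partitions" and T: "T \<in> dyadic_partitions" and f: "represents S T f"
    and U: "U \<in> dyadic_partitions" "S \<subseteq> U"
  shows "f ` U \<in> dyadic_partitions" "represents U (f ` U) f"
proof -
  note S' = dyadic_partitionsD(1)[OF S] and T' = dyadic_partitionsD(1)[OF T]
    and U' = dyadic_partitionsD(1)[OF U(1)]
  show fU: "represents U (f ` U) f"
    by (rule represents_refine[OF S' f U(2) unit_partitionsD(2)[OF U']])
  have "dyadic_interval y z" if yz: "consecutive (f ` U) y z" for y z
  proof -
    obtain a b where ab: "consecutive U a b" "y = f a" "z = f b"
      using yz unfolding consecutive_image_iff[OF representsD(2)[OF fU]] by blast
    obtain c d where cd: "consecutive S c d" "c \<le> a" "b \<le> d"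
      using consecutive_refine[OF S' U(2) unit_partitionsD(2)[OF U'] ab(1)] .
    show ?thesis
      using represents_dyadic_interval[OF S T f cd(1) dyadic_partitionsD(2)[OF U(1) ab(1)] cd(2,3)] ab by simp
  qed
  then show "f ` U \<in> dyadic_partitions"
    using image_unit_partition[OF S' T' f U'] by (simp add: dyadic_partitions_iff)
qed

section \<open>Thompson's group is a group\<close>

lemma thompson_F_iff:
  "f \<in> carrier thompson_F \<longleftrightarrow> (\<exists>S\<in>dyadic_partitions. \<exists>T\<in>dyadic_partitions. represents S T f)"
proof
  assume "f \<in> carrier thompson_F"
  then obtain S T where "f = represented_map S T" "S \<in> dyadic_partitions" "T \<in> dyadic_partitions"
    "card S = card T"
    by (auto simp: thompson_F_def)
  then show "\<exists>S\<in>dyadic_partitions. \<exists>T\<in>dyadic_partitions. represents S T f"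
    using represents_represented_map dyadic_partitionsD(1) by blast
next
  assume "\<exists>S\<in>dyadic_partitions. \<exists>T\<in>dyadic_partitions. represents S T f"
  then obtain S T where *: "S \<in> dyadic_partitions" "T \<in> dyadic_partitions" "represents S T f" by blast
  have "f = represented_map S T" using represented_map_eqI[OF dyadic_partitionsD(1)[OF *(1)] *(3)] by simp
  then show "f \<in> carrier thompson_F" using * represents_card[OF *(3)] by (auto simp: thompson_F_def)
qed

lemma thompson_F_Bij: "f \<in> carrier thompson_F \<Longrightarrow> f \<in> Bij {0..1}"
  using thompson_F_iff represents_Bij dyadic_partitionsD(1) by blast

lemma thompson_F_mult:
  assumes "f \<in> carrier thompson_F" "g \<in> carrier thompson_F"
  shows "g \<otimes>\<^bsub>thompson_F\<^esub> f = compose {0..1} g f"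
  using assms[THEN thompson_F_Bij] by (simp add: thompson_F_def BijGroup_def)

lemma trivial_partition_dyadic: "{0, 1} \<in> dyadic_partitions"
  unfolding dyadic_partitions_iff
proof (intro conjI allI impI)
  show "{0, 1} \<in> unit_partitions" by (simp add: unit_partitions_def)
  fix a b :: real assume ab: "consecutive {0, 1} a b"
  have "a = 0" "b = 1" using consecutiveD(1-3)[OF ab] by auto
  moreover have "dyadic_interval 0 1" unfolding dyadic_interval_def
    by (intro exI[of _ 0]) simp
  ultimately show "dyadic_interval a b" by simp
qed

text \<open>The range partition of \<open>f\<close> and the domain partition of \<open>g\<close> have a common dyadic refinement \<open>U\<close>. Pulling it
back along \<open>f\<close> and pushing it forward along \<open>g\<close> gives representations of the two maps that share
their middle partition.\<close>

lemma thompson_F_compose: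
  assumes "f \<in> carrier thompson_F" "g \<in> carrier thompson_F"
  shows "compose {0..1} g f \<in> carrier thompson_F"
proof -
  obtain S T where f: "S \<in> dyadic_partitions" "T \<in> dyadic_partitions" "represents S T f"
    using assms(1) thompson_F_iff by blast
  obtain P Q where g: "P \<in> dyadic_partitions" "Q \<in> dyadic_partitions" "represents P Q g"
    using assms(2) thompson_F_iff by blast
  note f' = f(1,2)[THEN dyadic_partitionsD(1)] and g' = g(1,2)[THEN dyadic_partitionsD(1)]
  obtain k where k: "represents T S k" "\<forall>x\<in>{0..1}. k (f x) = x"
    "\<forall>y\<in>{0..1}. f (k y) = y"
    by (rule represents_inverse[OF f' f(3)])
  define U where "U = T \<union> P"
  have U: "U \<in> dyadic_partitions" "T \<subseteq> U" "P \<subseteq> U"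
    using dyadic_partition_union f g by (auto simp: U_def)
  have V: "k ` U \<in> dyadic_partitions" "represents U (k ` U) k"
    using image_dyadic_refinement[OF f(2,1) k(1) U(1,2)] by auto
  have W: "g ` U \<in> dyadic_partitions" "represents U (g ` U) g"
    using image_dyadic_refinement[OF g U(1,3)] by auto
  note UV = dyadic_partitionsD(1)[OF U(1)] dyadic_partitionsD(1)[OF V(1)]
  have "represents (k ` U) U f"
    by (rule represents_inverse_function[OF UV V(2) representsD(1)[OF f(3)] represents_range(3)[OF f' f(3)] k(2)[rule_format]])
  then have "represents (k ` U) (g ` U) (compose {0..1} g f)"
    using W(2) unit_partitionsD(2)[OF UV(2)] by (rule represents_compose)
  then show ?thesis using V W thompson_F_iff by blast
qed

lemma thompson_F_one: "\<one>\<^bsub>thompson_F\<^esub> = (\<lambda>x\<in>{0..1}. x)"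
  by (simp add: thompson_F_def BijGroup_def)

lemma group_thompson_F: "group thompson_F"
proof (rule groupI)
  show "x \<otimes>\<^bsub>thompson_F\<^esub> y \<in> carrier thompson_F"
    if "x \<in> carrier thompson_F" "y \<in> carrier thompson_F" for x y
    using that thompson_F_compose thompson_F_mult by simp
  have "represents {0, 1} {0, 1} \<one>\<^bsub>thompson_F\<^esub>"
    unfolding thompson_F_one by (rule represents_identity) simp
  then show one: "\<one>\<^bsub>thompson_F\<^esub> \<in> carrier thompson_F"
    unfolding thompson_F_iff using trivial_partition_dyadic by blast
  show "x \<otimes>\<^bsub>thompson_F\<^esub> y \<otimes>\<^bsub>thompson_F\<^esub> z = x \<otimes>\<^bsub>thompson_F\<^esub> (y \<otimes>\<^bsub>thompson_F\<^esub> z)"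
    if x: "x \<in> carrier thompson_F" and y: "y \<in> carrier thompson_F" and z: "z \<in> carrier thompson_F" for x y z
  proof -
    have "compose {0..1} (compose {0..1} x y) z = compose {0..1} x (compose {0..1} y z)"
      by (rule compose_assoc[OF Bij_imp_funcset[OF thompson_F_Bij[OF z]], symmetric])
    then show ?thesis
      using thompson_F_mult thompson_F_compose x y z by simp
  qed
  show "\<one>\<^bsub>thompson_F\<^esub> \<otimes>\<^bsub>thompson_F\<^esub> x = x" if x: "x \<in> carrier thompson_F" for x
  proof -
    note Bij = thompson_F_Bij[OF x]
    have "compose {0..1} (\<lambda>x\<in>{0..1}. x) x = x"
      by (rule Id_compose[OF Bij_imp_funcset[OF Bij] Bij_imp_extensional[OF Bij]])
    then show ?thesis unfolding thompson_F_mult[OF x one] unfolding thompson_F_one .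
  qed
  show "\<exists>y\<in>carrier thompson_F. y \<otimes>\<^bsub>thompson_F\<^esub> x = \<one>\<^bsub>thompson_F\<^esub>" if x: "x \<in> carrier thompson_F" for x
  proof -
    obtain S T where f: "S \<in> dyadic_partitions" "T \<in> dyadic_partitions" "represents S T x"
      using x thompson_F_iff by blast
    obtain k where k: "represents T S k" "\<forall>y\<in>{0..1}. k (x y) = y"
      by (rule represents_inverse[OF f(1,2)[THEN dyadic_partitionsD(1)] f(3)])
    have kF: "k \<in> carrier thompson_F" using k f thompson_F_iff by blast
    moreover have "compose {0..1} k x = (\<lambda>x\<in>{0..1}. x)"
      using k(2) unfolding compose_def by (intro restrict_ext) simp
    ultimately show ?thesis using thompson_F_mult[OF x kF] thompson_F_one by metis
  qed
qed

section \<open>The dyadic partition adapted to a finite set\<close>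

text \<open>The interval is half-open: when points are spaced exactly \<open>1/16\<close> apart, an open interval of
length \<open>1/8\<close> may contain only one of them, but a half-open one always contains two.\<close>

definition crowded :: "real set \<Rightarrow> real \<Rightarrow> real \<Rightarrow> bool" where
  "crowded X a b \<longleftrightarrow> (\<exists>x\<in>X. \<exists>y\<in>X. a \<le> x \<and> x < y \<and> y < b)"

text \<open>The result of halving the unit interval as long as the pieces are crowded. Since any dyadic
interval around a crowded one is crowded, the halving reaches every crowded interval, and the points it
produces are their midpoints; this closed form avoids a recursion.\<close>

definition adapted :: "real set \<Rightarrow> real set" where
  "adapted X = {0, 1} \<union> {(a + b) / 2 | a b. dyadic_interval a b \<and> b \<le> 1 \<and> crowded X a b}"

lemma crowded_mono: "crowded X a b \<Longrightarrow> c \<le> a \<Longrightarrow> b \<le> d \<Longrightarrow> crowded X c d"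
  unfolding crowded_def by (meson less_le_trans order_trans)

text \<open>A crowded interval is longer than the smallest distance between two points of \<open>X\<close>, so only finitely
many dyadic lengths occur. This is the reason for asking for two points and not for one.\<close>

lemma finite_adapted:
  assumes "finite X"
  shows "finite (adapted X)"
proof -
  have "\<forall>\<^sub>F N in sequentially. \<forall>z\<in>{z \<in> X \<times> X. fst z < snd z}. (1 / 2) ^ N < snd z - fst z"
  proof (rule eventually_ball_finite)
    show "finite {z \<in> X \<times> X. fst z < snd z}" using assms by simp
    show "\<forall>z\<in>{z \<in> X \<times> X. fst z < snd z}. \<forall>\<^sub>F N in sequentially. (1 / 2) ^ N < snd z - fst z"
    proof
      fix z assume z: "z \<in> {z \<in> X \<times> X. fst z < snd z}"
      have "(\<lambda>N. (1 / 2 :: real) ^ N) \<longlonglongrightarrow> 0" by (rule LIMSEQ_power_zero) simp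
      then show "\<forall>\<^sub>F N in sequentially. (1 / 2) ^ N < snd z - fst z"
        by (rule order_tendstoD(2)) (use z in auto)
    qed
  qed
  then obtain N where N: "\<And>x y. x \<in> X \<Longrightarrow> y \<in> X \<Longrightarrow> x < y \<Longrightarrow> (1 / 2) ^ N < y - x"
    unfolding eventually_sequentially by fastforce
  have "adapted X \<subseteq> {0, 1} \<union> (\<lambda>(p, q). (real p / 2 ^ q + (real p + 1) / 2 ^ q) / 2) ` ({..2 ^ N} \<times> {..N})"
  proof
    fix m assume "m \<in> adapted X"
    then consider "m \<in> {0, 1}" | a b where "m = (a + b) / 2" "dyadic_interval a b" "b \<le> 1" "crowded X a b"
      unfolding adapted_def by blast
    then show "m \<in> {0, 1} \<union> (\<lambda>(p, q). (real p / 2 ^ q + (real p + 1) / 2 ^ q) / 2) ` ({..2 ^ N} \<times> {..N})"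
    proof cases
      case 2
      obtain x y where xy: "x \<in> X" "y \<in> X" "a \<le> x" "x < y" "y < b" using 2(4) by (auto simp: crowded_def)
      obtain p q :: nat where a: "a = real p / 2 ^ q" "b = (real p + 1) / 2 ^ q"
        using 2(2) by (auto simp: dyadic_interval_def)
      \<comment> \<open>The level \<open>q\<close> is bounded by \<open>N\<close>, and the numerator is bounded because the interval ends at 1 or before.\<close>
      have "b - a = (1 / 2) ^ q" by (simp add: a power_divide diff_divide_distrib [symmetric])
      then have "(1 / 2 :: real) ^ N < (1 / 2) ^ q" using N[OF xy(1,2,4)] xy by linarith
      then have q: "q \<le> N" by simp
      have "real (p + 1) \<le> real (2 ^ q)" using 2(3) by (simp add: a)
      then have "p + 1 \<le> 2 ^ q" by (simp only: of_nat_le_iff)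
      also have "\<dots> \<le> 2 ^ N" using q by simp
      finally show ?thesis using q 2(1) unfolding a by (intro UnI2 image_eqI[where x = "(p, q)"]) auto
    qed auto
  qed
  then show ?thesis by (rule finite_subset) simp
qed

lemma adapted_unit_partition:
  assumes "finite X"
  shows "adapted X \<in> unit_partitions"
proof -
  have "(a + b) / 2 \<in> {0..1}" if "dyadic_interval a b" "b \<le> 1" for a b
    using dyadic_interval_nonneg[OF that(1)] dyadic_interval_less[OF that(1)] that(2) by simp
  then have "adapted X \<subseteq> {0..1}" unfolding adapted_def by fastforce
  then show ?thesis using finite_adapted[OF assms] by (simp add: unit_partitions_def adapted_def)
qed

text \<open>The smallest dyadic interval containing \<open>[a, b]\<close>; the last two conclusions are its minimality: neither of
its halves contains \<open>[a, b]\<close>.\<close>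

lemma smallest_dyadic_interval_around:
  assumes "0 \<le> a" "a < b" "b \<le> 1"
  obtains c d where "dyadic_interval c d" "c \<le> a" "b \<le> d" "d \<le> 1"
    "\<not> b \<le> (c + d) / 2" "\<not> (c + d) / 2 \<le> a"
proof -
  define Q where "Q = (\<lambda>q. \<exists>p :: nat. real p / 2 ^ q \<le> a \<and> b \<le> (real p + 1) / 2 ^ q \<and> (real p + 1) / 2 ^ q \<le> 1)"
  obtain N where N: "(1 / 2 :: real) ^ N < b - a" using real_arch_pow_inv[of "b - a" "1/2"] assms by auto
  have bound: "q \<le> N" if "Q q" for q
  proof (rule ccontr)
    assume "\<not> q \<le> N"
    then have "(1 / 2 :: real) ^ q \<le> (1 / 2) ^ N" by (intro power_decreasing) auto
    moreover obtain p :: nat where "real p / 2 ^ q \<le> a" "b \<le> (real p + 1) / 2 ^ q" using \<open>Q q\<close> by (auto simp: Q_def)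
    then have "b - a \<le> (1 / 2) ^ q" by (simp add: power_divide add_divide_distrib)
    ultimately show False using N by linarith
  qed
  have "Q 0" unfolding Q_def using assms by (intro exI[of _ 0]) auto
  then obtain q where q: "Q q" "\<And>r. Q r \<Longrightarrow> r \<le> q" using GreatestI_nat[of Q 0 N] Greatest_le_nat[of Q _ N] bound by metis
  obtain p :: nat where p: "real p / 2 ^ q \<le> a" "b \<le> (real p + 1) / 2 ^ q" "(real p + 1) / 2 ^ q \<le> 1"
    using q(1) by (auto simp: Q_def)
  have half: "(real p / 2 ^ q + (real p + 1) / 2 ^ q) / 2 = (2 * real p + 1) / 2 ^ Suc q"
    by (simp add: field_simps)
  have nQ: "\<not> Q (Suc q)" using q(2) by fastforce
  show thesis
  proof (rule that)
    show "dyadic_interval (real p / 2 ^ q) ((real p + 1) / 2 ^ q)" by (auto simp: dyadic_interval_def)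
    show "\<not> b \<le> (real p / 2 ^ q + (real p + 1) / 2 ^ q) / 2"
    proof
      assume "b \<le> (real p / 2 ^ q + (real p + 1) / 2 ^ q) / 2"
      then have "b \<le> (real (2 * p) + 1) / 2 ^ Suc q" by (simp only: half) simp
      moreover have "real (2 * p) / 2 ^ Suc q \<le> a" using p by simp
      moreover have "(real (2 * p) + 1) / 2 ^ Suc q \<le> (real p + 1) / 2 ^ q" by (simp add: field_simps)
      ultimately have "Q (Suc q)" unfolding Q_def using p(3) order_trans by blast
      then show False using nQ by simp
    qed
    show "\<not> (real p / 2 ^ q + (real p + 1) / 2 ^ q) / 2 \<le> a"
    proof
      assume "(real p / 2 ^ q + (real p + 1) / 2 ^ q) / 2 \<le> a"
      then have "real (2 * p + 1) / 2 ^ Suc q \<le> a" by (simp only: half) (simp add: add.commute)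
      moreover have "(real (2 * p + 1) + 1) / 2 ^ Suc q = (real p + 1) / 2 ^ q" by (simp add: field_simps)
      ultimately have "Q (Suc q)" unfolding Q_def using p(2,3) by metis
      then show False using nQ by simp
    qed
  qed (use p in auto)
qed

text \<open>Let \<open>[a, b]\<close> be a gap and \<open>[c, d]\<close> the smallest dyadic interval around it. The midpoint of \<open>[c, d]\<close> lies
strictly between \<open>a\<close> and \<open>b\<close>, so \<open>[c, d]\<close> is not crowded. Then no dyadic interval inside it is crowded either,
hence no adapted point is interior to \<open>[c, d]\<close> and the gap is all of \<open>[c, d]\<close>.\<close>

lemma adapted_dyadic:
  assumes "finite X"
  shows "adapted X \<in> dyadic_partitions"
  unfolding dyadic_partitions_iff
proof (intro conjI allI impI)
  show U: "adapted X \<in> unit_partitions" by (rule adapted_unit_partition[OF assms])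
  fix a b assume ab: "consecutive (adapted X) a b"
  note abD = consecutiveD[OF ab]
  have ab': "0 \<le> a" "b \<le> 1" using consecutive_unit[OF U ab] by auto
  obtain c d where cd: "dyadic_interval c d" "c \<le> a" "b \<le> d" "d \<le> 1"
    "\<not> b \<le> (c + d) / 2" "\<not> (c + d) / 2 \<le> a"
    using smallest_dyadic_interval_around[OF ab'(1) abD(3) ab'(2)] .
  have "(c + d) / 2 \<notin> adapted X" using abD(4)[of "(c + d) / 2"] cd(5,6) by blast
  then have nc: "\<not> crowded X c d" using cd unfolding adapted_def by blast
  have out: "m \<le> c \<or> d \<le> m" if m: "m \<in> adapted X" for m
  proof (rule ccontr)
    assume *: "\<not> (m \<le> c \<or> d \<le> m)"
    then have "m \<noteq> 0" "m \<noteq> 1" using dyadic_interval_nonneg[OF cd(1)] cd(4) by auto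
    then obtain a' b' where ab': "m = (a' + b') / 2" "dyadic_interval a' b'" "crowded X a' b'"
      using m unfolding adapted_def by blast
    have "c \<le> a'" "b' \<le> d" using dyadic_interval_midpoint_inside[OF cd(1) ab'(2)] * ab'(1) by auto
    then show False using nc crowded_mono[OF ab'(3)] by blast
  qed
  have "a = c" "b = d" using out[OF abD(1)] out[OF abD(2)] cd abD(3) by auto
  then show "dyadic_interval a b" using cd(1) by simp
qed

text \<open>An inner point \<open>s\<close> of \<open>S\<close> is the midpoint of a dyadic interval that contains the gap to the right of \<open>s\<close>, and
that interval inherits crowdedness from the gap.\<close>

lemma partition_subset_adapted:
  assumes S: "S \<in> dyadic_partitions" and X: "\<And>a b. consecutive S a b \<Longrightarrow> crowded X a b"
  shows "S \<subseteq> adapted X"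
proof
  fix s assume s: "s \<in> S"
  note S' = dyadic_partitionsD(1)[OF S]
  show "s \<in> adapted X"
  proof (cases "s = 0 \<or> s = 1")
    case True
    then show ?thesis by (auto simp: adapted_def)
  next
    case False
    then have s01: "0 < s" "s < 1" using s unit_partitionsD(2)[OF S'] by force+
    obtain a t where "consecutive S a t" "a \<le> s" "s < t"
      using consecutive_around'[OF S', of s] s01 by auto
    moreover from this have "a = s" using consecutiveD(4)[of S a t s] s by auto
    ultimately have st: "consecutive S s t" by simp
    obtain c d where cd: "dyadic_interval c d" "s = (c + d) / 2" "t \<le> d" "d \<le> 1"
      using dyadic_left_endpoint_is_midpoint[OF dyadic_partitionsD(2)[OF S st] s01(1)]
        consecutive_unit(3)[OF S' st] by blast
    have "crowded X c d" using crowded_mono[OF X[OF st], of c d] cd dyadic_interval_less[OF cd(1)] by simp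
    then show ?thesis using cd unfolding adapted_def by blast
  qed
qed

lemma crowded_image:
  assumes mono: "strict_mono_on {0..1} f" and "X \<subseteq> {0..1}" "a \<in> {0..1}" "b \<in> {0..1}" "crowded X a b"
  shows "crowded (f ` X) (f a) (f b)"
proof -
  obtain x y where xy: "x \<in> X" "y \<in> X" "a \<le> x" "x < y" "y < b" using assms by (auto simp: crowded_def)
  moreover from this have "x \<in> {0..1}" "y \<in> {0..1}" using assms by auto
  ultimately have "f a \<le> f x" "f x < f y" "f y < f b"
    using assms strict_mono_on_leD[OF mono] strict_mono_onD[OF mono] by blast+
  then show ?thesis using xy unfolding crowded_def by blast
qed

text \<open>An adapted point of \<open>X\<close> either belongs to \<open>S\<close>, and is mapped into \<open>T\<close>, all of whose points are adapted to
the image because its gaps are crowded too; or it is interior to a gap of \<open>S\<close>. In the second case it is the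
midpoint of a crowded dyadic interval inside that gap, where the map is affine and preserves dyadic
intervals, midpoints and crowdedness.\<close>

lemma adapted_image_subset:
  assumes S: "S \<in> dyadic_partitions" and T: "T \<in> dyadic_partitions" and f: "represents S T f"
    and X: "X \<subseteq> {0..1}" "\<And>a b. consecutive S a b \<Longrightarrow> crowded X a b"
  shows "\<And>a b. consecutive T a b \<Longrightarrow> crowded (f ` X) a b" "f ` adapted X \<subseteq> adapted (f ` X)"
proof -
  note S' = dyadic_partitionsD(1)[OF S] and T' = dyadic_partitionsD(1)[OF T]
  note mono = represents_strict_mono[OF S' f]
  show crowdedT: "crowded (f ` X) y z" if yz: "consecutive T y z" for y z
  proof -
    have "consecutive (f ` S) y z" using yz representsD(3)[OF f] by simp
    then obtain a b where ab: "consecutive S a b" "y = f a" "z = f b"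
      unfolding consecutive_image_iff[OF representsD(2)[OF f]] by blast
    then show ?thesis
      using crowded_image[OF mono X(1) _ _ X(2)[OF ab(1)]] consecutive_unit[OF S' ab(1)] by simp
  qed
  show "f ` adapted X \<subseteq> adapted (f ` X)"
  proof
    fix y assume "y \<in> f ` adapted X"
    then obtain m where m: "m \<in> adapted X" "y = f m" by blast
    show "y \<in> adapted (f ` X)"
    proof (cases "m \<in> S")
      case True
      then show ?thesis
        using partition_subset_adapted[OF T crowdedT] representsD(3)[OF f] m(2) by blast
    next
      case False
      then have "m \<noteq> 0" "m \<noteq> 1" using unit_partitionsD[OF S'] by auto
      then obtain c d where cd: "m = (c + d) / 2" "dyadic_interval c d" "d \<le> 1" "crowded X c d"
        using m(1) unfolding adapted_def by blast
      have "0 \<le> c" "c < d" using dyadic_interval_nonneg[OF cd(2)] dyadic_interval_less[OF cd(2)] .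
      then have "0 < m" "m \<le> 1" using cd(1,3) by auto
      then obtain a b where ab: "consecutive S a b" "a < m" "m \<le> b"
        by (rule consecutive_around[OF S'])
      have "m < b" using ab(3) False consecutiveD(2)[OF ab(1)] by (cases "m = b") auto
      then have le: "a \<le> c" "d \<le> b"
        using dyadic_interval_midpoint_inside[OF dyadic_partitionsD(2)[OF S ab(1)] cd(2)] ab(2) cd(1) by auto
      have "dyadic_interval (f c) (f d)" by (rule represents_dyadic_interval[OF S T f ab(1) cd(2) le])
      moreover have "f d \<le> 1" using represents_range(3)[OF S' T' f, of d] \<open>0 \<le> c\<close> \<open>c < d\<close> cd(3) by simp
      moreover have "crowded (f ` X) (f c) (f d)"
        using crowded_image[OF mono X(1) _ _ cd(4)] \<open>0 \<le> c\<close> \<open>c < d\<close> cd(3) by simp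
      moreover have "f m = (f c + f d) / 2"
      proof -
        obtain \<alpha> \<beta> where aff: "\<forall>x\<in>{a..b}. f x = \<alpha> * x + \<beta>" using represents_affine[OF f ab(1)] by blast
        have "f ((1 - 1 / 2) * c + 1 / 2 * d) = (1 - 1 / 2) * f c + 1 / 2 * f d"
          by (rule affine_convex_combination[where \<alpha> = \<alpha> and \<beta> = \<beta>]) (use aff le \<open>c < d\<close> in auto)
        moreover have "(1 - 1 / 2) * c + 1 / 2 * d = m" "(1 - 1 / 2) * f c + 1 / 2 * f d = (f c + f d) / 2"
          by (simp_all add: cd(1) add_divide_distrib)
        ultimately show ?thesis by metis
      qed
      ultimately show ?thesis unfolding adapted_def m(2) by blast
    qed
  qed
qed

text \<open>The inverse of \<open>f\<close> satisfies the same hypotheses for the image of \<open>X\<close>, which gives the missing inclusion.\<close>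

lemma adapted_image:
  assumes S: "S \<in> dyadic_partitions" and T: "T \<in> dyadic_partitions" and f: "represents S T f"
    and X: "X \<subseteq> {0..1}" "\<And>a b. consecutive S a b \<Longrightarrow> crowded X a b"
    and fin: "finite X"
  shows "adapted (f ` X) = f ` adapted X"
proof
  note S' = dyadic_partitionsD(1)[OF S] and T' = dyadic_partitionsD(1)[OF T]
  obtain g where g: "represents T S g" "\<forall>x\<in>{0..1}. g (f x) = x" "\<forall>y\<in>{0..1}. f (g y) = y"
    by (rule represents_inverse[OF S' T' f])
  have fX: "f ` X \<subseteq> {0..1}" using represents_range(3)[OF S' T' f] X(1) by blast
  have "g ` f ` X = X" using g(2) X(1) by (force simp: image_image)
  then have *: "g ` adapted (f ` X) \<subseteq> adapted X"
    using adapted_image_subset(2)[OF T S g(1) fX adapted_image_subset(1)[OF S T f X]] by simp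
  show "adapted (f ` X) \<subseteq> f ` adapted X"
  proof
    fix y assume y: "y \<in> adapted (f ` X)"
    then have "y \<in> {0..1}" using unit_partitionsD(2)[OF adapted_unit_partition[of "f ` X"]] fin by auto
    then have "y = f (g y)" using g(3) by simp
    then show "y \<in> f ` adapted X" using * y by blast
  qed
  show "f ` adapted X \<subseteq> adapted (f ` X)" by (rule adapted_image_subset(2)[OF S T f X])
qed

lemma consecutive_le_mesh:
  assumes "X \<in> unit_partitions" "consecutive X a b"
  shows "b - a \<le> mesh X"
  unfolding mesh_def
proof (rule Max_ge)
  have "{b - a | a b. consecutive X a b} \<subseteq> (\<lambda>(a, b). b - a) ` (X \<times> X)"
    by (auto dest: consecutiveD)
  then show "finite {b - a | a b. consecutive X a b}"
    by (rule finite_subset) (simp add: unit_partitionsD(1)[OF assms(1)])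
qed (use assms in blast)

text \<open>Two steps of size at most the mesh, taken to the left from \<open>b\<close>, stay in \<open>[a, b)\<close>; the first step ends
strictly before \<open>b\<close> and the second may end at \<open>a\<close>.\<close>

lemma crowded_of_mesh:
  assumes X: "X \<in> unit_partitions" and "0 \<le> a" "b \<le> 1" "2 * mesh X \<le> b - a"
    and "a < b"
  shows "crowded X a b"
proof -
  obtain y z where y: "consecutive X y z" "y < b" "b \<le> z"
    using consecutive_around[OF X, of b] assms by auto
  have *: "b - mesh X \<le> y" using consecutive_le_mesh[OF X y(1)] y by linarith
  then obtain x w where x: "consecutive X x w" "x < y" "y \<le> w"
    using consecutive_around[OF X, of y] assms y by auto
  have "a \<le> x" using consecutive_le_mesh[OF X x(1)] x * assms by linarith
  then show ?thesis using x y consecutiveD(1)[OF x(1)] consecutiveD(1)[OF y(1)] unfolding crowded_def by blast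
qed

section \<open>Subdividing dyadic partitions\<close>

lemma insert_midpoint_dyadic:
  assumes T: "T \<in> dyadic_partitions" and ab: "consecutive T a b"
  shows "insert ((a + b) / 2) T \<in> dyadic_partitions"
  unfolding dyadic_partitions_iff
proof (intro conjI allI impI)
  note T' = dyadic_partitionsD(1)[OF T]
  note abD = consecutiveD[OF ab] and halves = dyadic_interval_halves[OF dyadic_partitionsD(2)[OF T ab]]
  show "insert ((a + b) / 2) T \<in> unit_partitions"
    using unit_partitionsD[OF T'] consecutive_unit[OF T' ab] by (auto simp: unit_partitions_def)
  fix u v assume uv: "consecutive (insert ((a + b) / 2) T) u v"
  note uvD = consecutiveD[OF uv]
  consider "u = (a + b) / 2" | "v = (a + b) / 2" | "u \<in> T" "v \<in> T" using uvD(1,2) by blast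
  then show "dyadic_interval u v"
  proof cases
    case 1
    then have "v \<in> T" using uvD(2,3) by auto
    then have "v = b" using abD(4)[of v] uvD(3) uvD(4)[of b] 1 abD(2,3) by auto
    then show ?thesis using halves(2) 1 by (simp only:)
  next
    case 2
    then have "u \<in> T" using uvD(1,3) by auto
    then have "u = a" using abD(4)[of u] uvD(3) uvD(4)[of a] 2 abD(1,3) by auto
    then show ?thesis using halves(1) 2 by (simp only:)
  next
    case 3
    then have "consecutive T u v" using uvD by (intro consecutiveI) auto
    then show ?thesis by (rule dyadic_partitionsD(2)[OF T])
  qed
qed

lemma shortest_leaf:
  assumes T: "T \<in> unit_partitions"
  obtains a b where "consecutive T a b" "\<And>c d. consecutive T c d \<Longrightarrow> b - a \<le> d - c"
proof -
  define W where "W = {b - a | a b. consecutive T a b}"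
  have "W \<subseteq> (\<lambda>(a, b). b - a) ` (T \<times> T)"
    unfolding W_def by (auto dest: consecutiveD)
  then have fin: "finite W" by (rule finite_subset) (simp add: unit_partitionsD(1)[OF T])
  obtain a b where "consecutive T a b" using consecutive_around[OF T zero_less_one order_refl] by metis
  then have "W \<noteq> {}" by (auto simp: W_def)
  then have "Min W \<in> W" using fin by simp
  then obtain a b where ab: "consecutive T a b" "Min W = b - a" unfolding W_def by blast
  have "b - a \<le> d - c" if "consecutive T c d" for c d
    unfolding ab(2)[symmetric] using that fin by (intro Min_le) (auto simp: W_def)
  then show thesis using that ab(1) by blast
qed

text \<open>Consider a shortest gap \<open>[a, b]\<close> and the dyadic interval \<open>[x, y]\<close> of which it is one half. The gap next to it
on the side of the other half begins or ends at the midpoint of \<open>[x, y]\<close> and is at least as long as that half.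
If it were longer than \<open>[x, y]\<close> it would contain \<open>[x, y]\<close> by nestedness, which is impossible as it ends
at the midpoint; so it is contained in \<open>[x, y]\<close> and equals the other half.\<close>

lemma sibling_leaves:
  assumes T: "T \<in> dyadic_partitions" and nontrivial: "T \<noteq> {0, 1}"
  obtains x y where "consecutive T x ((x + y) / 2)" "consecutive T ((x + y) / 2) y" "dyadic_interval x y"
proof -
  note T' = dyadic_partitionsD(1)[OF T]
  obtain a b where ab: "consecutive T a b" and short: "\<And>c d. consecutive T c d \<Longrightarrow> b - a \<le> d - c"
    using shortest_leaf[OF T'] by metis
  note abD = consecutiveD[OF ab] and ab01 = consecutive_unit[OF T' ab]
  obtain p q :: nat where pq: "a = real p / 2 ^ q" "b = (real p + 1) / 2 ^ q"
    using dyadic_partitionsD(2)[OF T ab] by (auto simp: dyadic_interval_def)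
  have "q \<noteq> 0"
  proof
    assume "q = 0"
    then have "a = 0" "b = 1" using pq ab01 by auto
    then have "T = {0, 1}" using abD unit_partitionsD[OF T'] by force
    then show False using nontrivial by simp
  qed
  then obtain r where q: "q = Suc r" using not0_implies_Suc by blast
  \<comment> \<open>The interval one level up that contains \<open>[a, b]\<close>; the parity of \<open>p\<close> decides which half \<open>[a, b]\<close> is.\<close>
  define x y where "x = real (p div 2) / 2 ^ r" and "y = (real (p div 2) + 1) / 2 ^ r"
  have xy: "dyadic_interval x y" unfolding x_def y_def dyadic_interval_def by blast
  have "real (p + 1) \<le> real (2 * 2 ^ r)" using ab01(3) by (simp add: pq q)
  then have "p + 1 \<le> 2 * 2 ^ r" by (simp only: of_nat_le_iff)
  then have "p div 2 + 1 \<le> 2 ^ r" by linarith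
  then have "real (p div 2 + 1) \<le> real (2 ^ r)" by (simp only: of_nat_le_iff)
  then have y1: "y \<le> 1" by (simp add: y_def)
  have x0: "0 \<le> x" by (simp add: x_def)
  show thesis
  proof (cases "even p")
    case True
    then have p: "real p = 2 * real (p div 2)" by (metis dvd_mult_div_cancel of_nat_mult of_nat_numeral)
    have a: "a = x" and b: "b = (x + y) / 2"
      unfolding pq q p x_def y_def by (simp_all add: field_simps)
    have "0 \<le> b" "b < 1" using abD(3) ab01(1) a b y1 by auto
    then obtain b' c where c: "consecutive T b' c" "b' \<le> b" "b < c"
      by (rule consecutive_around'[OF T'])
    have "b' = b" using consecutiveD(4)[OF c(1) abD(2)] c by auto
    with c have c: "consecutive T b c" by simp
    note bc = dyadic_partitionsD(2)[OF T c]
    have "y \<le> c" using short[OF c] a b by argo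
    moreover have "c - b \<le> y - x"
      using dyadic_interval_nested(1)[OF bc xy] consecutiveD(3)[OF c] abD(3) a b \<open>y \<le> c\<close> by argo
    then have "c \<le> y"
      using dyadic_interval_nested(2)[OF xy bc] consecutiveD(3)[OF c] abD(3) a b by argo
    ultimately have "c = y" by simp
    then show thesis using that[of x y] ab c a b xy by simp
  next
    case False
    then have "p = 2 * (p div 2) + 1" by (metis odd_two_times_div_two_succ)
    then have p: "real p = 2 * real (p div 2) + 1" by (metis of_nat_1 of_nat_add of_nat_mult of_nat_numeral)
    have b: "b = y" and a: "a = (x + y) / 2"
      unfolding pq q p x_def y_def by (simp_all add: field_simps)
    have "0 < a" "a \<le> 1" using abD(3) ab01(3) a b x0 by auto
    then obtain c a' where c: "consecutive T c a'" "c < a" "a \<le> a'"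
      by (rule consecutive_around[OF T'])
    have "a' = a" using consecutiveD(4)[OF c(1) abD(1)] c by auto
    with c have c: "consecutive T c a" by simp
    note ca = dyadic_partitionsD(2)[OF T c]
    have "c \<le> x" using short[OF c] a b by argo
    moreover have "a - c \<le> y - x"
      using dyadic_interval_nested(2)[OF ca xy] consecutiveD(3)[OF c] abD(3) a b \<open>c \<le> x\<close> by argo
    then have "x \<le> c"
      using dyadic_interval_nested(1)[OF xy ca] consecutiveD(3)[OF c] abD(3) a b by argo
    ultimately have "c = x" by simp
    then show thesis using that[of x y] ab c a b xy by simp
  qed
qed

text \<open>The induction principle for dyadic partitions: two sibling gaps are merged into one by deleting the
midpoint between them.\<close>

lemma dyadic_partition_remove_caret:
  assumes T: "T \<in> dyadic_partitions" and nontrivial: "T \<noteq> {0, 1}"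
  obtains T' x y where "T' \<in> dyadic_partitions" "consecutive T' x y"
    "T = insert ((x + y) / 2) T'" "(x + y) / 2 \<notin> T'"
proof -
  note TU = dyadic_partitionsD(1)[OF T]
  obtain x y where xy: "consecutive T x ((x + y) / 2)" "consecutive T ((x + y) / 2) y" "dyadic_interval x y"
    using sibling_leaves[OF T nontrivial] .
  define m where "m = (x + y) / 2"
  note xm = consecutiveD[OF xy(1), folded m_def] and my = consecutiveD[OF xy(2), folded m_def]
  have leaf: "u = x \<and> v = y \<or> consecutive T u v" if uv: "consecutive (T - {m}) u v" for u v
  proof (cases "u < m \<and> m < v")
    case True
    have "u \<le> x" using xm(4)[of u] consecutiveD(1)[OF uv] True by auto
    moreover have "x \<le> u" using consecutiveD(4)[OF uv, of x] xm(1,3) True by auto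
    moreover have "y \<le> v" using my(4)[of v] consecutiveD(2)[OF uv] True by auto
    moreover have "v \<le> y" using consecutiveD(4)[OF uv, of y] my(2,3) True by auto
    ultimately show ?thesis by simp
  next
    case False
    then have out: "z \<le> u \<or> v \<le> z" if "z \<in> T" for z
      using consecutiveD(4)[OF uv, of z] that by (cases "z = m") auto
    have "consecutive T u v"
      by (rule consecutiveI[OF _ _ _ out]) (use consecutiveD(1-3)[OF uv] in auto)
    then show ?thesis ..
  qed
  have xym: "consecutive (T - {m}) x y"
    using xm my by (intro consecutiveI) force+
  have "T - {m} \<in> unit_partitions"
    using unit_partitionsD[OF TU] consecutive_unit[OF TU xy(1)] consecutive_unit[OF TU xy(2)]
    unfolding unit_partitions_def m_def[symmetric] by auto
  then have "T - {m} \<in> dyadic_partitions"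
    using leaf xy(3) dyadic_partitionsD(2)[OF T] unfolding dyadic_partitions_iff by blast
  moreover have "T = insert m (T - {m})" using xm by blast
  moreover have "m \<notin> T - {m}" by simp
  ultimately show thesis using xym by (intro that[of "T - {m}" x y, folded m_def])
qed

section \<open>Combs\<close>

text \<open>The partition of a binary tree all of whose carets lie on the right spine. It serves as the base point for
the dyadic partitions with \<open>k + 2\<close> points; the point for \<open>i = 0\<close> is 0.\<close>

definition comb :: "nat \<Rightarrow> real set" where
  "comb k = insert 1 ((\<lambda>i. 1 - 1 / 2 ^ i) ` {..k})"

lemma comb_pointI: "i \<le> k \<Longrightarrow> 1 - 1 / 2 ^ i \<in> comb k"
  by (auto simp: comb_def)

lemma comb_point_le_iff: "1 - 1 / 2 ^ i \<le> (1 - 1 / 2 ^ j :: real) \<longleftrightarrow> i \<le> j"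
  by (simp add: field_simps)

lemma comb_point_less_iff: "1 - 1 / 2 ^ i < (1 - 1 / 2 ^ j :: real) \<longleftrightarrow> i < j"
  by (simp add: field_simps)

lemma comb_midpoint: "(1 - 1 / 2 ^ i + 1) / 2 = (1 - 1 / 2 ^ Suc i :: real)"
  by (simp add: field_simps)

lemma dyadic_interval_tail: "dyadic_interval (1 - 1 / 2 ^ i) 1"
proof (induction i)
  case 0
  show ?case unfolding dyadic_interval_def by (intro exI[of _ 0]) simp
next
  case (Suc i)
  show ?case using dyadic_interval_halves(2)[OF Suc] unfolding comb_midpoint .
qed

lemma consecutive_comb:
  assumes "consecutive (comb k) a b"
  obtains i where "i \<le> k" "a = 1 - 1 / 2 ^ i" "b = (if i = k then 1 else 1 - 1 / 2 ^ Suc i)"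
proof -
  note ab = consecutiveD[OF assms]
  have le1: "x \<le> 1" if "x \<in> comb k" for x using that by (auto simp: comb_def)
  then have "a \<noteq> 1" using ab(2,3) by fastforce
  then obtain i where i: "i \<le> k" "a = 1 - 1 / 2 ^ i" using ab(1) by (auto simp: comb_def)
  consider "b = 1" | j where "b = 1 - 1 / 2 ^ j" "j \<le> k" using ab(2) by (auto simp: comb_def)
  then have "b = (if i = k then 1 else 1 - 1 / 2 ^ Suc i)"
  proof cases
    case 1
    have "i = k"
    proof (rule ccontr)
      assume "i \<noteq> k"
      then have "1 - 1 / 2 ^ Suc i \<in> comb k" using i(1) by (intro comb_pointI) simp
      then have "1 - 1 / 2 ^ Suc i \<le> a \<or> 1 \<le> (1 - 1 / 2 ^ Suc i :: real)" using ab(4) 1 by blast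
      then show False
      proof
        assume "1 - 1 / 2 ^ Suc i \<le> a"
        then show False unfolding i(2) comb_point_le_iff by simp
      next
        assume "1 \<le> (1 - 1 / 2 ^ Suc i :: real)"
        moreover have "0 < (1 / 2 ^ Suc i :: real)" by simp
        ultimately show False by linarith
      qed
    qed
    then show ?thesis using 1 by simp
  next
    case 2
    then have "i < j" using ab(3) comb_point_less_iff unfolding i(2) by blast
    then have "1 - 1 / 2 ^ Suc i \<in> comb k" using 2 by (intro comb_pointI) simp
    then have "j \<le> Suc i" using ab(4)[of "1 - 1 / 2 ^ Suc i"] unfolding i(2) 2(1) comb_point_le_iff by simp
    then have "j = Suc i" using \<open>i < j\<close> by simp
    then show ?thesis using 2 by simp
  qed
  then show thesis using that i by blast
qed

lemma comb_dyadic: "comb k \<in> dyadic_partitions"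
  unfolding dyadic_partitions_iff
proof (intro conjI allI impI)
  have "1 - 1 / 2 ^ 0 \<in> comb k" unfolding comb_def by blast
  then show "comb k \<in> unit_partitions"
    by (auto simp: unit_partitions_def comb_def)
  fix a b assume "consecutive (comb k) a b"
  then obtain i where i: "i \<le> k" "a = 1 - 1 / 2 ^ i" "b = (if i = k then 1 else 1 - 1 / 2 ^ Suc i)"
    by (rule consecutive_comb)
  then show "dyadic_interval a b"
    using dyadic_interval_tail[of i] dyadic_interval_halves(1)[OF dyadic_interval_tail[of i]]
    unfolding comb_midpoint by (cases "i = k") simp_all
qed

lemma card_comb: "card (comb k) = k + 2"
proof -
  have "inj_on (\<lambda>i. 1 - 1 / 2 ^ i :: real) {..k}"
    by (rule inj_onI) (metis comb_point_le_iff le_antisym order_refl)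
  then have "card ((\<lambda>i. 1 - 1 / 2 ^ i :: real) ` {..k}) = k + 1" by (simp add: card_image)
  moreover have "(1::real) \<notin> (\<lambda>i. 1 - 1 / 2 ^ i) ` {..k}" by auto
  ultimately show ?thesis by (simp add: comb_def)
qed

lemma comb_Suc: "comb (Suc k) = insert (1 - 1 / 2 ^ Suc k) (comb k)"
  unfolding comb_def atMost_Suc by auto

section \<open>The generators\<close>

text \<open>The generator \<open>x\<^sub>0\<close> in the coordinate \<open>s = 1 - t\<close>. On \<open>[0, 1]\<close> it is the minimum of three affine
functions with slopes 2, 1 and 1/2. The maximum with \<open>s\<close> extends it by the identity beyond 1, so that the
same formula, rescaled by powers of two, describes all generators.\<close>

definition spine_shift :: "real \<Rightarrow> real" where
  "spine_shift s = max s (min (2 * s) (min (s + 1 / 4) (1 / 2 + s / 2)))"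

text \<open>The standard generator \<open>x\<^sub>j\<close>: the identity up to \<open>1 - 1/2\<^sup>j\<close>, and a copy of \<open>x\<^sub>0\<close> scaled to the rest.\<close>

definition comb_shift :: "nat \<Rightarrow> real \<Rightarrow> real" where
  "comb_shift j = (\<lambda>t\<in>{0..1}. 1 - spine_shift (2 ^ j * (1 - t)) / 2 ^ j)"

lemma spine_shift_strict_mono: "x < y \<Longrightarrow> spine_shift x < spine_shift y"
  by (auto simp: spine_shift_def min_def max_def)

lemma spine_shift_pieces:
  "1 \<le> s \<Longrightarrow> spine_shift s = s"
  "1 / 2 \<le> s \<Longrightarrow> s \<le> 1 \<Longrightarrow> spine_shift s = 1 / 2 + s / 2"
  "1 / 4 \<le> s \<Longrightarrow> s \<le> 1 / 2 \<Longrightarrow> spine_shift s = s + 1 / 4"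
  "0 \<le> s \<Longrightarrow> s \<le> 1 / 4 \<Longrightarrow> spine_shift s = 2 * s"
  by (auto simp: spine_shift_def min_def max_def)

lemma comb_shift_pieces:
  fixes j :: nat
  defines "z \<equiv> 1 / 2 ^ j :: real"
  shows "0 \<le> t \<Longrightarrow> t \<le> 1 - z \<Longrightarrow> comb_shift j t = t"
    "1 - z \<le> t \<Longrightarrow> t \<le> 1 - z / 2 \<Longrightarrow> comb_shift j t = t / 2 + (1 - z) / 2"
    "1 - z / 2 \<le> t \<Longrightarrow> t \<le> 1 - z / 4 \<Longrightarrow> comb_shift j t = t - z / 4"
    "1 - z / 4 \<le> t \<Longrightarrow> t \<le> 1 \<Longrightarrow> comb_shift j t = 2 * t - 1"
proof -
  define w :: real where "w = 2 ^ j"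
  have w: "0 < w" "1 \<le> w" and z: "z = 1 / w" "0 < z" "z \<le> 1" by (simp_all add: w_def z_def)
  have wz: "w * z = 1" using w z by simp
  have eq: "comb_shift j t = 1 - spine_shift (w * (1 - t)) * z" if "t \<in> {0..1}" for t
    using that by (simp add: comb_shift_def w_def z_def)
  have le: "w * (1 - t) \<le> w * (c * z) \<longleftrightarrow> 1 - c * z \<le> t" "w * (c * z) \<le> w * (1 - t) \<longleftrightarrow> t \<le> 1 - c * z"
    "w * (c * z) = c" for c t using w wz by auto
  \<comment> \<open>Rescaling there and back; after this every piece is linear arithmetic.\<close>
  have wtz: "w * (1 - t) * z = 1 - t" for t using wz by (metis mult.assoc mult.commute mult_1)
  show "comb_shift j t = t" if "0 \<le> t" "t \<le> 1 - z"
  proof -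
    have "spine_shift (w * (1 - t)) = w * (1 - t)"
      using that le(2)[of 1 t] le(3)[of 1] by (intro spine_shift_pieces(1)) auto
    then show ?thesis using eq[of t] that z(2) wtz[of t] by simp
  qed
  show "comb_shift j t = t / 2 + (1 - z) / 2" if "1 - z \<le> t" "t \<le> 1 - z / 2"
  proof -
    have "spine_shift (w * (1 - t)) = 1 / 2 + w * (1 - t) / 2"
      using that le(1)[of t 1] le(2)[of "1/2" t] le(3)[of 1] le(3)[of "1/2"]
      by (intro spine_shift_pieces(2)) auto
    then have "spine_shift (w * (1 - t)) * z = z / 2 + w * (1 - t) * z / 2" by (simp add: distrib_right)
    moreover have "comb_shift j t = 1 - spine_shift (w * (1 - t)) * z" by (rule eq) (use that z(2,3) in auto)
    ultimately show ?thesis using wtz[of t] by argo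
  qed
  show "comb_shift j t = t - z / 4" if "1 - z / 2 \<le> t" "t \<le> 1 - z / 4"
  proof -
    have "spine_shift (w * (1 - t)) = w * (1 - t) + 1 / 4"
      using that le(1)[of t "1/2"] le(2)[of "1/4" t] le(3)[of "1/4"] le(3)[of "1/2"]
      by (intro spine_shift_pieces(3)) auto
    then have "spine_shift (w * (1 - t)) * z = z / 4 + w * (1 - t) * z" by (simp add: distrib_right)
    moreover have "comb_shift j t = 1 - spine_shift (w * (1 - t)) * z" by (rule eq) (use that z(2,3) in auto)
    ultimately show ?thesis using wtz[of t] by argo
  qed
  show "comb_shift j t = 2 * t - 1" if "1 - z / 4 \<le> t" "t \<le> 1"
  proof -
    have "w * (1 - t) \<le> w * (z / 4)" using that w by (intro mult_left_mono) auto
    also have "\<dots> = 1 / 4" using wz by simp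
    finally have "spine_shift (w * (1 - t)) = 2 * (w * (1 - t))"
      using that w by (intro spine_shift_pieces(4)) auto
    then have "spine_shift (w * (1 - t)) * z = 2 * (w * (1 - t) * z)" by simp
    moreover have "comb_shift j t = 1 - spine_shift (w * (1 - t)) * z" by (rule eq) (use that z(2,3) in auto)
    ultimately show ?thesis using wtz[of t] by argo
  qed
qed

text \<open>For \<open>j = 0\<close> the first two points of the domain partition coincide, as do those of the range partition.\<close>

lemma represents_comb_shift:
  fixes j :: nat
  defines "z \<equiv> 1 / 2 ^ j :: real"
  shows "represents {0, 1 - z, 1 - z / 2, 1 - z / 4, 1} {0, 1 - z, 1 - 3 * z / 4, 1 - z / 2, 1} (comb_shift j)"
    (is "represents ?S ?T _")
  unfolding represents_def
proof (intro conjI allI impI ballI)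
  note pieces = comb_shift_pieces[where j = j, folded z_def]
  have z: "0 < z" "z \<le> 1" by (simp_all add: z_def)
  show "comb_shift j \<in> extensional {0..1}" by (simp add: comb_shift_def)
  have "strict_mono_on {0..1} (comb_shift j)"
    by (rule strict_mono_onI) (auto simp: comb_shift_def intro!: divide_strict_right_mono spine_shift_strict_mono)
  then show "strict_mono_on ?S (comb_shift j)" by (rule monotone_on_subset) (use z in auto)
  have "comb_shift j 0 = 0" "comb_shift j (1 - z) = 1 - z" "comb_shift j (1 - z / 2) = 1 - 3 * z / 4"
    "comb_shift j (1 - z / 4) = 1 - z / 2" "comb_shift j 1 = 1"
    using pieces(1)[of 0] pieces(1)[of "1 - z"] pieces(2)[of "1 - z / 2"] pieces(3)[of "1 - z / 4"]
      pieces(4)[of 1] z by (auto simp: field_simps)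
  then show "comb_shift j ` ?S = ?T" by (simp add: insert_commute)
  fix a b u assume ab: "consecutive ?S a b" and u: "u \<in> {0..1::real}"
  note abD = consecutiveD[OF ab]
  have ab01: "0 \<le> a" "b \<le> 1" using abD(1,2) z by auto
  consider "b \<le> 1 - z" | "1 - z \<le> a" "b \<le> 1 - z / 2" | "1 - z / 2 \<le> a" "b \<le> 1 - z / 4" | "1 - z / 4 \<le> a"
    using abD(4)[of "1 - z"] abD(4)[of "1 - z / 2"] abD(4)[of "1 - z / 4"] by auto
  then show "comb_shift j ((1 - u) * a + u * b) = (1 - u) * comb_shift j a + u * comb_shift j b"
  proof cases
    case 1
    show ?thesis
      by (rule affine_convex_combination[where \<alpha> = 1 and \<beta> = 0]) (use 1 ab01 abD(3) u pieces(1) in auto)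
  next
    case 2
    show ?thesis
      by (rule affine_convex_combination[where \<alpha> = "1 / 2" and \<beta> = "(1 - z) / 2"])
        (use 2 ab01 abD(3) u pieces(2) in auto)
  next
    case 3
    show ?thesis
      by (rule affine_convex_combination[where \<alpha> = 1 and \<beta> = "- z / 4"])
        (use 3 ab01 abD(3) u pieces(3) in auto)
  next
    case 4
    show ?thesis
      by (rule affine_convex_combination[where \<alpha> = 2 and \<beta> = "- 1"])
        (use 4 ab01 abD(3) u pieces(4) in auto)
  qed
qed

lemma thompson_x0_eq: "thompson_x0 = comb_shift 0"
proof -
  have "represents {0, 1/2, 3/4, 1} {0, 1/4, 1/2, 1} (comb_shift 0)"
    using represents_comb_shift[of 0] by simp
  then show ?thesis unfolding thompson_x0_def
    by (rule represented_map_eqI[rotated]) (auto simp: unit_partitions_def)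
qed

lemma thompson_x1_eq: "thompson_x1 = comb_shift 1"
proof -
  have "represents {0, 1/2, 3/4, 7/8, 1} {0, 1/2, 5/8, 3/4, 1} (comb_shift 1)"
    using represents_comb_shift[of 1] by simp
  then show ?thesis unfolding thompson_x1_def
    by (rule represented_map_eqI[rotated]) (auto simp: unit_partitions_def)
qed

lemma comb_shift_point:
  "i \<le> j \<Longrightarrow> comb_shift j (1 - 1 / 2 ^ i) = 1 - 1 / 2 ^ i"
  "comb_shift j (1 - 1 / 2 ^ Suc j) = (1 - 1 / 2 ^ j + (1 - 1 / 2 ^ Suc j)) / 2"
  "j < i \<Longrightarrow> comb_shift j (1 - 1 / 2 ^ Suc i) = 1 - 1 / 2 ^ i"
proof -
  note pieces = comb_shift_pieces[where j = j]
  show "comb_shift j (1 - 1 / 2 ^ i) = 1 - 1 / 2 ^ i" if "i \<le> j"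
    using that by (intro pieces(1)) (simp_all add: comb_point_le_iff)
  show "comb_shift j (1 - 1 / 2 ^ Suc j) = (1 - 1 / 2 ^ j + (1 - 1 / 2 ^ Suc j)) / 2"
    using pieces(2)[of "1 - 1 / 2 ^ Suc j"] by (simp add: field_simps)
  show "comb_shift j (1 - 1 / 2 ^ Suc i) = 1 - 1 / 2 ^ i" if "j < i"
  proof -
    have "Suc (Suc j) \<le> Suc i" using that by simp
    then have "1 - 1 / 2 ^ Suc (Suc j) \<le> (1 - 1 / 2 ^ Suc i :: real)" by (simp only: comb_point_le_iff)
    moreover have "1 - 1 / 2 ^ j / 4 = (1 - 1 / 2 ^ Suc (Suc j) :: real)" by simp
    ultimately have "comb_shift j (1 - 1 / 2 ^ Suc i) = 2 * (1 - 1 / 2 ^ Suc i) - 1"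
      by (intro pieces(4)) simp_all
    then show ?thesis by simp
  qed
qed

text \<open>On a sufficiently long comb the generator \<open>x\<^sub>j\<close> is the change of base point caused by a caret at the
\<open>j\<close>-th interval: it slides the points to the right of that interval one place to the left and
makes room for the midpoint.\<close>

lemma represents_comb_shift_comb:
  assumes "j < k"
  shows "represents (comb (Suc k)) (insert ((1 - 1 / 2 ^ j + (1 - 1 / 2 ^ Suc j)) / 2) (comb k)) (comb_shift j)"
proof -
  define m :: real where "m = (1 - 1 / 2 ^ j + (1 - 1 / 2 ^ Suc j)) / 2"
  let ?z = "1 / 2 ^ j :: real"
  let ?S = "{0, 1 - ?z, 1 - ?z / 2, 1 - ?z / 4, 1}"
  have S: "?S \<in> unit_partitions"
  proof -
    have "{0, 1 - z, 1 - z / 2, 1 - z / 4, 1} \<in> unit_partitions" if "0 < z" "z \<le> 1" for z :: real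
      using that by (auto simp: unit_partitions_def)
    from this[of ?z] show ?thesis by simp
  qed
  have e: "0 = (1 - 1 / 2 ^ 0 :: real)" "1 - ?z / 2 = 1 - 1 / 2 ^ Suc j" "1 - ?z / 4 = 1 - 1 / 2 ^ Suc (Suc j)"
    by simp_all
  note p = comb_pointI[of _ "Suc k"]
  have sub: "?S \<subseteq> comb (Suc k)"
    using p[of 0] p[of j] p[of "Suc j"] p[of "Suc (Suc j)"] assms unfolding e by (auto simp: comb_def)
  have "comb_shift j ` comb (Suc k) = insert m (comb k)"
  proof (rule equalityI; rule subsetI)
    fix y assume "y \<in> comb_shift j ` comb (Suc k)"
    then consider "y = comb_shift j 1" | i where "i \<le> Suc k" "y = comb_shift j (1 - 1 / 2 ^ i)"
      by (auto simp: comb_def)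
    then show "y \<in> insert m (comb k)"
    proof cases
      case 1
      then show ?thesis using comb_shift_pieces(4)[of j 1] by (simp add: comb_def)
    next
      case 2
      consider "i \<le> j" | "i = Suc j" | l where "i = Suc l" "j < l"
        by (metis Suc_lessI less_Suc_eq_le not_less not0_implies_Suc less_nat_zero_code gr_implies_not0 lessE)
      then show ?thesis
      proof cases
        case 1
        then have "y = 1 - 1 / 2 ^ i" unfolding 2(2) by (rule comb_shift_point(1))
        then show ?thesis using comb_pointI[of i k] 1 assms by simp
      next
        case 2
        then have "y = m" unfolding \<open>y = comb_shift j (1 - 1 / 2 ^ i)\<close> m_def by (simp only: comb_shift_point(2))
        then show ?thesis by simp
      next
        case 3
        then have "y = 1 - 1 / 2 ^ l" unfolding 2(2) by (simp only: comb_shift_point(3))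
        then show ?thesis using comb_pointI[of l k] 2(1) 3(1) by simp
      qed
    qed
  next
    fix y assume "y \<in> insert m (comb k)"
    then consider "y = m" | "y = 1" | i where "i \<le> k" "y = 1 - 1 / 2 ^ i" by (auto simp: comb_def)
    then show "y \<in> comb_shift j ` comb (Suc k)"
    proof cases
      case 1
      then have "y = comb_shift j (1 - 1 / 2 ^ Suc j)" by (simp only: comb_shift_point(2) m_def)
      then show ?thesis by (rule image_eqI) (rule p, use assms in simp)
    next
      case 2
      then have "y = comb_shift j 1" using comb_shift_pieces(4)[of j 1] by simp
      then show ?thesis by (rule image_eqI) (simp add: comb_def)
    next
      case 3
      show ?thesis
      proof (cases "i \<le> j")
        case True
        then have "y = comb_shift j (1 - 1 / 2 ^ i)" using comb_shift_point(1) 3 by simp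
        then show ?thesis by (rule image_eqI) (rule p, use 3 in simp)
      next
        case False
        then have "y = comb_shift j (1 - 1 / 2 ^ Suc i)" using comb_shift_point(3)[of j i] 3 by simp
        then show ?thesis by (rule image_eqI) (rule p, use 3 in simp)
      qed
    qed
  qed
  then show ?thesis
    using represents_refine[OF S represents_comb_shift sub]
      unit_partitionsD(2)[OF dyadic_partitionsD(1)[OF comb_dyadic]] unfolding m_def by simp
qed

lemma comb_interval_consecutive:
  assumes "j < k"
  shows "consecutive (comb k) (1 - 1 / 2 ^ j) (1 - 1 / 2 ^ Suc j)"
proof (rule consecutiveI)
  show "1 - 1 / 2 ^ j \<in> comb k" "1 - 1 / 2 ^ Suc j \<in> comb k"
    using assms by (auto intro!: comb_pointI simp del: power_Suc)
  show "1 - 1 / 2 ^ j < (1 - 1 / 2 ^ Suc j :: real)" by (simp only: comb_point_less_iff)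
  fix x assume "x \<in> comb k"
  then consider "x = 1" | i where "x = 1 - 1 / 2 ^ i" by (auto simp: comb_def)
  then show "x \<le> 1 - 1 / 2 ^ j \<or> 1 - 1 / 2 ^ Suc j \<le> x"
    by cases (simp, simp only: comb_point_le_iff, linarith)
qed

lemma comb_shift_in_F: "comb_shift j \<in> carrier thompson_F"
  unfolding thompson_F_iff
proof (intro bexI)
  show "represents (comb (Suc (Suc j))) (insert ((1 - 1 / 2 ^ j + (1 - 1 / 2 ^ Suc j)) / 2) (comb (Suc j))) (comb_shift j)"
    by (rule represents_comb_shift_comb[OF lessI])
  show "insert ((1 - 1 / 2 ^ j + (1 - 1 / 2 ^ Suc j)) / 2) (comb (Suc j)) \<in> dyadic_partitions"
    by (rule insert_midpoint_dyadic[OF comb_dyadic comb_interval_consecutive[OF lessI]])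
qed (rule comb_dyadic)

text \<open>Here \<open>w\<close> stands for \<open>2 ^ (j + 1)\<close>. For \<open>s \<le> 1/4\<close> the outer map is doubling, which exchanges the two
scales; for larger \<open>s\<close> both rescaled maps act as the identity. For \<open>w = 1\<close> the identity
fails, so \<open>x\<^sub>1\<close> is not obtained from \<open>x\<^sub>0\<close> in this way.\<close>

lemma spine_shift_conjugate:
  assumes "2 \<le> w" "0 \<le> s"
  shows "spine_shift (spine_shift (2 * w * s) / (2 * w)) = spine_shift (w * spine_shift s) / w"
proof (cases "s \<le> 1 / 4")
  case True
  have mono: "spine_shift x \<le> spine_shift y" if "x \<le> y" for x y
    using spine_shift_strict_mono[of x y] that by (cases "x = y") auto
  have "2 * w * s \<le> 2 * w * (1 / 4)" using True assms by (intro mult_left_mono) auto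
  then have "spine_shift (2 * w * s) \<le> spine_shift (w / 2)" by (intro mono) simp
  also have "\<dots> = w / 2" using assms by (intro spine_shift_pieces(1)) simp
  finally have "spine_shift (2 * w * s) / (2 * w) \<le> 1 / 4" using assms by (simp add: field_simps)
  moreover have "spine_shift 0 \<le> spine_shift (2 * w * s)" using assms by (intro mono) simp
  then have "0 \<le> spine_shift (2 * w * s) / (2 * w)" using spine_shift_pieces(4)[of 0] assms by simp
  ultimately have "spine_shift (spine_shift (2 * w * s) / (2 * w)) = 2 * (spine_shift (2 * w * s) / (2 * w))"
    by (intro spine_shift_pieces(4))
  then show ?thesis using assms True spine_shift_pieces(4)[of s] by (simp add: mult.assoc mult.left_commute)
next
  case False
  have "2 * (1 / 2) \<le> w * (2 * s)" using False assms by (intro mult_mono) auto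
  then have "spine_shift (2 * w * s) = 2 * w * s" by (intro spine_shift_pieces(1)) (simp add: mult_ac)
  then have l: "spine_shift (2 * w * s) / (2 * w) = s" using assms by simp
  have "1 / 2 \<le> spine_shift s" using False by (auto simp: spine_shift_def max_def min_def)
  then have "2 * (1 / 2) \<le> w * spine_shift s" using assms by (intro mult_mono) auto
  then have "spine_shift (w * spine_shift s) = w * spine_shift s" by (intro spine_shift_pieces(1)) simp
  then show ?thesis using l assms by simp
qed

lemma comb_shift_conjugate:
  "compose {0..1} (comb_shift 0) (comb_shift (Suc (Suc j))) = compose {0..1} (comb_shift (Suc j)) (comb_shift 0)"
proof (rule extensionalityI)
  fix t :: real assume t: "t \<in> {0..1}"
  have range: "comb_shift i t \<in> {0..1}" for i
    using Bij_imp_funcset[OF thompson_F_Bij[OF comb_shift_in_F]] t by blast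
  have "2 \<le> (2 :: real) ^ Suc j" by simp
  then show "compose {0..1} (comb_shift 0) (comb_shift (Suc (Suc j))) t
      = compose {0..1} (comb_shift (Suc j)) (comb_shift 0) t"
    using t range[of 0] range[of "Suc (Suc j)"] spine_shift_conjugate[of "2 ^ Suc j" "1 - t"]
    by (simp add: compose_eq) (simp add: comb_shift_def)
qed (auto simp: compose_def)

lemma comb_shift_generated:
  "comb_shift j \<in> generate thompson_F {thompson_x0, thompson_x1}"
proof (induction j rule: less_induct)
  case (less j)
  interpret group thompson_F by (rule group_thompson_F)
  let ?H = "generate thompson_F {thompson_x0, thompson_x1}"
  consider "j = 0" | "j = 1" | i where "j = Suc (Suc i)" by (metis One_nat_def not0_implies_Suc)
  then show ?case
  proof cases
    case 1
    then show ?thesis by (auto simp: thompson_x0_eq[symmetric] intro: generate.incl)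
  next
    case 2
    then show ?thesis by (auto simp: thompson_x1_eq[symmetric, unfolded One_nat_def] intro: generate.incl)
  next
    case 3
    note F = comb_shift_in_F
    have "comb_shift 0 \<otimes>\<^bsub>thompson_F\<^esub> comb_shift j = comb_shift (Suc i) \<otimes>\<^bsub>thompson_F\<^esub> comb_shift 0"
      using comb_shift_conjugate[of i] F 3 by (simp add: thompson_F_mult)
    then have "comb_shift j = inv\<^bsub>thompson_F\<^esub> comb_shift 0 \<otimes>\<^bsub>thompson_F\<^esub> (comb_shift (Suc i) \<otimes>\<^bsub>thompson_F\<^esub> comb_shift 0)"
      using F by (simp add: inv_solve_left)
    moreover have "inv\<^bsub>thompson_F\<^esub> comb_shift 0 \<in> ?H" unfolding thompson_x0_eq by (intro generate.inv) simp
    ultimately show ?thesis using less[of 0] less[of "Suc i"] 3 by (auto intro: generate.eng)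
  qed
qed

section \<open>Generation\<close>

lemma represents_insert_midpoint:
  assumes S: "S \<in> unit_partitions" and f: "represents S T f" and ab: "consecutive S a b"
  shows "represents (insert ((a + b) / 2) S) (insert ((f a + f b) / 2) T) f"
proof -
  note ab01 = consecutive_unit[OF S ab]
  have "insert ((a + b) / 2) S \<subseteq> {0..1}" using unit_partitionsD(2)[OF S] ab01 by auto
  moreover have "f ((a + b) / 2) = (f a + f b) / 2"
    using representsD(4)[OF f ab, of "1 / 2"] by (simp add: field_simps)
  ultimately show ?thesis
    using represents_refine[OF S f subset_insertI] representsD(3)[OF f] by (metis image_insert)
qed

text \<open>Write \<open>T\<close> as \<open>T'\<close> with the midpoint of a gap added, and let \<open>h\<close> be the map from the comb to \<open>T'\<close>. The gap is the
image under \<open>h\<close> of the \<open>i\<close>-th interval of the comb, so \<open>h\<close> also maps the comb with the midpoint of that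
interval added to \<open>T\<close>. If the interval is the last one, the enlarged comb is again a comb and the map is
unchanged; otherwise the map from the longer comb to \<open>T\<close> is \<open>h \<circ> x\<^sub>i\<close>.\<close>

lemma comb_map_generated:
  assumes "T \<in> dyadic_partitions" "card T = k + 2" "represents (comb k) T g"
  shows "g \<in> generate thompson_F {thompson_x0, thompson_x1}"
  using assms
proof (induction k arbitrary: T g)
  case 0
  have "comb 0 = {0, 1}" by (auto simp: comb_def)
  moreover have "T = {0, 1}"
    using unit_partitionsD[OF dyadic_partitionsD(1)[OF 0(1)]] 0(2) by (intro card_subset_eq[symmetric]) auto
  ultimately have "represents {0, 1} {0, 1} g" using 0(3) by simp
  then have "g = \<one>\<^bsub>thompson_F\<^esub>"
    unfolding thompson_F_one
    by (rule represents_unique[OF dyadic_partitionsD(1)[OF trivial_partition_dyadic]]) (simp add: represents_identity)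
  then show ?case by (simp add: generate.one)
next
  case (Suc k)
  note C = dyadic_partitionsD(1)[OF comb_dyadic]
  have "T \<noteq> {0, 1}" using Suc.prems(2) by auto
  then obtain T' x y where T': "T' \<in> dyadic_partitions" "consecutive T' x y"
    "T = insert ((x + y) / 2) T'" "(x + y) / 2 \<notin> T'"
    by (rule dyadic_partition_remove_caret[OF Suc.prems(1)])
  note TU = dyadic_partitionsD(1)[OF T'(1)]
  have card: "card T' = k + 2" using Suc.prems(2) T'(3,4) unit_partitionsD(1)[OF TU] by simp
  then obtain h where h: "represents (comb k) T' h" using represents_exists[OF C TU] card_comb by metis
  have hH: "h \<in> generate thompson_F {thompson_x0, thompson_x1}" by (rule Suc.IH[OF T'(1) card h])
  have "consecutive (h ` comb k) x y" using T'(2) representsD(3)[OF h] by simp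
  then obtain a b where ab: "consecutive (comb k) a b" "x = h a" "y = h b"
    unfolding consecutive_image_iff[OF representsD(2)[OF h]] by blast
  have h': "represents (insert ((a + b) / 2) (comb k)) T h"
    using represents_insert_midpoint[OF C h ab(1)] unfolding T'(3) ab(2,3) .
  obtain i where i: "i \<le> k" "a = 1 - 1 / 2 ^ i" "b = (if i = k then 1 else 1 - 1 / 2 ^ Suc i)"
    using consecutive_comb[OF ab(1)] .
  show ?case
  proof (cases "i = k")
    case True
    then have a: "a = 1 - 1 / 2 ^ k" and b: "b = 1" using i by simp_all
    have "insert ((a + b) / 2) (comb k) = comb (Suc k)"
      unfolding a b comb_midpoint comb_Suc ..
    then have "g = h" using represents_unique[OF C Suc.prems(3)] h' by simp
    then show ?thesis using hH by simp
  next
    case False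
    then have ik: "i < k" using i by simp
    have "represents (comb (Suc k)) (insert ((a + b) / 2) (comb k)) (comb_shift i)"
      using represents_comb_shift_comb[OF ik] i False by simp
    then have "represents (comb (Suc k)) T (compose {0..1} h (comb_shift i))"
      using h' unit_partitionsD(2)[OF C] by (rule represents_compose)
    then have "g = compose {0..1} h (comb_shift i)" by (rule represents_unique[OF C Suc.prems(3)])
    moreover have "h \<in> carrier thompson_F" unfolding thompson_F_iff using h comb_dyadic T'(1) by blast
    ultimately have "g = h \<otimes>\<^bsub>thompson_F\<^esub> comb_shift i" using thompson_F_mult[OF comb_shift_in_F] by simp
    then show ?thesis using hH comb_shift_generated by (auto intro: generate.eng)
  qed
qed

lemma generators_in_F: "{thompson_x0, thompson_x1} \<subseteq> carrier thompson_F"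
  using comb_shift_in_F by (simp add: thompson_x0_eq thompson_x1_eq)

text \<open>If \<open>h\<close> is the map from the comb to the domain partition of \<open>f\<close>, then \<open>f \<circ> h\<close> is the map from the comb to the
range partition, and \<open>f\<close> is a quotient of two maps of the kind just treated.\<close>

theorem thompson_F_generated: "generate thompson_F {thompson_x0, thompson_x1} = carrier thompson_F"
proof
  interpret group thompson_F by (rule group_thompson_F)
  let ?H = "generate thompson_F {thompson_x0, thompson_x1}"
  show "?H \<subseteq> carrier thompson_F" by (rule generate_incl[OF generators_in_F])
  show "carrier thompson_F \<subseteq> ?H"
  proof
    fix f assume fF: "f \<in> carrier thompson_F"
    then obtain S T where f: "S \<in> dyadic_partitions" "T \<in> dyadic_partitions" "represents S T f"
      unfolding thompson_F_iff by blast
    note U = dyadic_partitionsD(1)[OF f(1)] and C = dyadic_partitionsD(1)[OF comb_dyadic]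
    have "card {0, 1 :: real} \<le> card S" using unit_partitionsD[OF U] by (intro card_mono) auto
    then obtain k where k: "card S = k + 2" by (metis add.commute card_2_iff le_Suc_ex zero_neq_one)
    obtain h where h: "represents (comb k) S h" using represents_exists[OF C U] card_comb k by metis
    have hH: "h \<in> ?H" by (rule comb_map_generated[OF f(1) k h])
    have "represents (comb k) T (compose {0..1} f h)"
      using h f(3) unit_partitionsD(2)[OF C] by (rule represents_compose)
    then have fh: "compose {0..1} f h \<in> ?H"
      using comb_map_generated[OF f(2)] k represents_card[OF f(3)] by simp
    have hF: "h \<in> carrier thompson_F" unfolding thompson_F_iff using h comb_dyadic f(1) by blast
    have "f = (f \<otimes>\<^bsub>thompson_F\<^esub> h) \<otimes>\<^bsub>thompson_F\<^esub> inv\<^bsub>thompson_F\<^esub> h"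
      using fF hF by (simp add: m_assoc)
    moreover have "f \<otimes>\<^bsub>thompson_F\<^esub> h \<in> ?H" using fh thompson_F_mult[OF hF fF] by simp
    moreover have "inv\<^bsub>thompson_F\<^esub> h \<in> ?H" by (rule generate_m_inv_closed[OF generators_in_F hH])
    ultimately show "f \<in> ?H" by (metis generate.eng)
  qed
qed

section \<open>Invariant means from almost invariant measures\<close>

definition additive_probability :: "('a, 'b) monoid_scheme \<Rightarrow> ('a set \<Rightarrow> real) \<Rightarrow> bool" where
  "additive_probability G \<nu> \<longleftrightarrow>
     (\<forall>A. \<nu> A \<in> {0..1}) \<and> \<nu> (carrier G) = 1 \<and>
     (\<forall>A \<subseteq> carrier G. \<forall>B \<subseteq> carrier G. A \<inter> B = {} \<longrightarrow> \<nu> (A \<union> B) = \<nu> A + \<nu> B)"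

text \<open>Tychonoff's theorem, in the product topology on the function type.\<close>

lemma compact_unit_cube: "compact {\<nu> :: 'a \<Rightarrow> real. \<forall>x. \<nu> x \<in> {0..1}}"
proof -
  have "compactin (product_topology (\<lambda>_ :: 'a. euclidean :: real topology) UNIV) (PiE UNIV (\<lambda>_. {0..1}))"
    unfolding compactin_PiE by simp
  then have "compact (PiE UNIV (\<lambda>_. {0..1}) :: ('a \<Rightarrow> real) set)"
    unfolding euclidean_product_topology by simp
  moreover have "PiE UNIV (\<lambda>_. {0..1}) = {\<nu> :: 'a \<Rightarrow> real. \<forall>x. \<nu> x \<in> {0..1}}"
    by (auto simp: PiE_def Pi_def)
  ultimately show ?thesis by simp
qed

text \<open>A cluster point of the measures for \<open>\<epsilon> = 1/(n + 1)\<close>. The filter \<open>F\<close> below refines both the sequence and the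
neighbourhoods of the cluster point: evaluation at any fixed set converges along it, and whatever
holds for almost all members of the sequence holds eventually, so equations and inequalities
between finitely many values pass to the limit.\<close>

lemma invariant_limit:
  fixes G (structure)
  assumes "group G"
    and approx: "\<And>\<epsilon>::real. 0 < \<epsilon> \<Longrightarrow> \<exists>\<nu>. additive_probability G \<nu> \<and>
      (\<forall>g\<in>K. \<forall>A\<subseteq>carrier G. \<bar>\<nu> (g <# A) - \<nu> A\<bar> \<le> \<epsilon>)"
  shows "\<exists>\<mu>. additive_probability G \<mu> \<and> (\<forall>g\<in>K. \<forall>A\<subseteq>carrier G. \<mu> (g <# A) = \<mu> A)"
proof -
  have "\<forall>n::nat. \<exists>\<nu>. additive_probability G \<nu> \<and>
      (\<forall>g\<in>K. \<forall>A\<subseteq>carrier G. \<bar>\<nu> (g <# A) - \<nu> A\<bar> \<le> 1 / real (Suc n))"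
    using approx by simp
  then obtain \<nu> where \<nu>: "\<And>n::nat. additive_probability G (\<nu> n)"
    "\<And>n g A. g \<in> K \<Longrightarrow> A \<subseteq> carrier G \<Longrightarrow> \<bar>\<nu> n (g <# A) - \<nu> n A\<bar> \<le> 1 / real (Suc n)"
    by metis
  let ?S = "filtermap \<nu> sequentially"
  let ?U = "{\<nu> :: 'a set \<Rightarrow> real. \<forall>x. \<nu> x \<in> {0..1}}"
  have "?S \<noteq> bot" by (simp add: filtermap_bot_iff)
  moreover have "eventually (\<lambda>\<nu>. \<nu> \<in> ?U) ?S"
    using \<nu>(1) by (simp add: eventually_filtermap additive_probability_def)
  ultimately obtain \<mu> where \<mu>: "\<mu> \<in> ?U" "inf (nhds \<mu>) ?S \<noteq> bot"
    using compact_unit_cube[unfolded compact_filter] by blast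
  define F where "F = inf (nhds \<mu>) ?S"
  have F: "F \<noteq> bot" "F \<le> nhds \<mu>" "F \<le> ?S" using \<mu>(2) by (simp_all add: F_def)
  have lim: "((\<lambda>m. m A) \<longlongrightarrow> \<mu> A) F" for A
  proof -
    have "continuous_on UNIV (\<lambda>m :: 'a set \<Rightarrow> real. m A)" by simp
    then have "((\<lambda>m. m A) \<longlongrightarrow> \<mu> A) (at \<mu>)"
      unfolding continuous_on_def by blast
    then have "((\<lambda>m. m A) \<longlongrightarrow> \<mu> A) (nhds \<mu>)"
      by (rule tendsto_at_iff_tendsto_nhds[THEN iffD1])
    then show ?thesis using F(2) by (rule tendsto_mono[rotated])
  qed
  have ev: "eventually P F" if "eventually (\<lambda>n. P (\<nu> n)) sequentially" for P
    using that F(3) unfolding le_filter_def eventually_filtermap by blast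
  have "\<mu> (carrier G) = 1"
  proof (rule tendsto_unique[OF F(1) lim])
    have "eventually (\<lambda>m. m (carrier G) = 1) F"
      using \<nu>(1) by (intro ev) (simp add: additive_probability_def)
    then show "((\<lambda>m. m (carrier G)) \<longlongrightarrow> 1) F" by (rule tendsto_eventually)
  qed
  moreover have "\<mu> (A \<union> B) = \<mu> A + \<mu> B"
    if "A \<subseteq> carrier G" "B \<subseteq> carrier G" "A \<inter> B = {}" for A B
  proof (rule tendsto_unique[OF F(1) lim])
    have "eventually (\<lambda>m. m (A \<union> B) = m A + m B) F"
      using \<nu>(1) that by (intro ev) (simp add: additive_probability_def)
    then show "((\<lambda>m. m (A \<union> B)) \<longlongrightarrow> \<mu> A + \<mu> B) F"
      using tendsto_add[OF lim[of A] lim[of B]] by (simp add: tendsto_cong)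
  qed
  moreover have "\<mu> (g <# A) = \<mu> A" if g: "g \<in> K" and A: "A \<subseteq> carrier G" for g A
  proof -
    have "\<bar>\<mu> (g <# A) - \<mu> A\<bar> \<le> \<epsilon>" if eps: "0 < \<epsilon>" for \<epsilon> :: real
    proof (rule tendsto_upperbound[OF _ _ F(1)])
      show "((\<lambda>m. \<bar>m (g <# A) - m A\<bar>) \<longlongrightarrow> \<bar>\<mu> (g <# A) - \<mu> A\<bar>) F"
        by (intro tendsto_intros lim)
      obtain N where N: "1 / real (Suc N) < \<epsilon>" using nat_approx_posE[OF eps] by blast
      have "\<bar>\<nu> n (g <# A) - \<nu> n A\<bar> \<le> \<epsilon>" if "N \<le> n" for n
      proof -
        have "1 / real (Suc n) \<le> 1 / real (Suc N)" using that by (simp add: field_simps)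
        then show ?thesis using \<nu>(2)[OF g A, of n] N by linarith
      qed
      then show "eventually (\<lambda>m. \<bar>m (g <# A) - m A\<bar> \<le> \<epsilon>) F"
        by (intro ev) (auto simp: eventually_sequentially)
    qed
    then have "\<bar>\<mu> (g <# A) - \<mu> A\<bar> \<le> 0" by (rule field_le_epsilon) simp
    then show ?thesis by simp
  qed
  ultimately show ?thesis using \<mu>(1) unfolding additive_probability_def by blast
qed

lemma invariant_under_generated:
  fixes G (structure)
  assumes "group G" and K: "K \<subseteq> carrier G"
    and inv: "\<And>g A. g \<in> K \<Longrightarrow> A \<subseteq> carrier G \<Longrightarrow> \<mu> (g <# A) = \<mu> A"
    and "h \<in> generate G K" "A \<subseteq> carrier G"
  shows "\<mu> (h <# A) = \<mu> A"
proof -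
  interpret group G by fact
  show ?thesis using assms(4,5)
  proof (induction h arbitrary: A)
    case one
    then show ?case by (simp add: lcos_mult_one)
  next
    case (incl h)
    then show ?case by (rule inv)
  next
    case (inv h)
    have h: "h \<in> carrier G" using inv K by blast
    have "\<mu> (inv h <# A) = \<mu> (h <# (inv h <# A))"
      using assms(3)[OF inv(1) l_coset_subset_G[OF inv(2) inv_closed[OF h]]] by simp
    also have "h <# (inv h <# A) = A"
      using h inv(2) by (simp add: lcos_m_assoc lcos_mult_one)
    finally show ?case .
  next
    case (eng h1 h2)
    have h: "h1 \<in> carrier G" "h2 \<in> carrier G" using eng(1,2) generate_in_carrier[OF K] by auto
    have "\<mu> (h1 \<otimes> h2 <# A) = \<mu> (h1 <# (h2 <# A))"
      using h eng.prems by (simp add: lcos_m_assoc)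
    also have "\<dots> = \<mu> (h2 <# A)" by (rule eng.IH(1)[OF l_coset_subset_G[OF eng.prems h(2)]])
    also have "\<dots> = \<mu> A" by (rule eng.IH(2)[OF eng.prems])
    finally show ?case .
  qed
qed

lemma amenable_if_almost_invariant:
  fixes G (structure)
  assumes "group G" and K: "K \<subseteq> carrier G" "generate G K = carrier G"
    and approx: "\<And>\<epsilon>::real. 0 < \<epsilon> \<Longrightarrow> \<exists>\<nu>. additive_probability G \<nu> \<and>
      (\<forall>g\<in>K. \<forall>A\<subseteq>carrier G. \<bar>\<nu> (g <# A) - \<nu> A\<bar> \<le> \<epsilon>)"
  shows "amenable G"
proof -
  obtain \<mu> where \<mu>: "additive_probability G \<mu>" "\<forall>g\<in>K. \<forall>A\<subseteq>carrier G. \<mu> (g <# A) = \<mu> A"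
    using invariant_limit[OF assms(1) approx] by blast
  have "\<mu> (g <# A) = \<mu> A" if "g \<in> carrier G" "A \<subseteq> carrier G" for g A
    using invariant_under_generated[OF assms(1) K(1), of \<mu> g A] \<mu>(2) that K(2) by blast
  then show ?thesis
    using assms(1) \<mu>(1) unfolding amenable_def additive_probability_def by auto
qed

lemma card_Int_diff_le:
  assumes "finite A" "finite B"
  shows "\<bar>real (card (A \<inter> P)) - real (card (B \<inter> P))\<bar> \<le> real (card (sym_diff A B))"
proof -
  have *: "card (C \<inter> P) \<le> card (D \<inter> P) + card (sym_diff C D)" if "finite C" "finite D" for C D :: "'a set"
  proof -
    have "card (C \<inter> P) \<le> card ((D \<inter> P) \<union> sym_diff C D)" using that by (intro card_mono) auto
    also have "\<dots> \<le> card (D \<inter> P) + card (sym_diff C D)" by (rule card_Un_le)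
    finally show ?thesis .
  qed
  have "sym_diff B A = sym_diff A B" by blast
  then show ?thesis using *[OF assms] *[OF assms(2,1)] by simp
qed

lemma uniform_pushforward:
  fixes \<Phi> :: "'x \<Rightarrow> 'a" and G :: "('a, 'b) monoid_scheme"
  assumes "finite \<A>" "\<A> \<noteq> {}" "\<Phi> ` \<A> \<subseteq> carrier G"
  shows "additive_probability G (\<lambda>E. real (card (\<A> \<inter> \<Phi> -` E)) / real (card \<A>))"
  unfolding additive_probability_def
proof (intro conjI allI impI)
  have pos: "0 < real (card \<A>)" using assms by (simp add: card_gt_0_iff)
  show "real (card (\<A> \<inter> \<Phi> -` E)) / real (card \<A>) \<in> {0..1}" for E
    using card_mono[OF assms(1), of "\<A> \<inter> \<Phi> -` E"] pos by simp
  have "\<A> \<inter> \<Phi> -` carrier G = \<A>" using assms(3) by blast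
  then show "real (card (\<A> \<inter> \<Phi> -` carrier G)) / real (card \<A>) = 1" using pos by simp
  fix A B :: "'a set" assume "A \<inter> B = {}"
  then have "card (\<A> \<inter> \<Phi> -` (A \<union> B)) = card (\<A> \<inter> \<Phi> -` A) + card (\<A> \<inter> \<Phi> -` B)"
    unfolding vimage_Un Int_Un_distrib using assms(1) by (intro card_Un_disjoint) auto
  then show "real (card (\<A> \<inter> \<Phi> -` (A \<union> B))) / real (card \<A>)
      = real (card (\<A> \<inter> \<Phi> -` A)) / real (card \<A>) + real (card (\<A> \<inter> \<Phi> -` B)) / real (card \<A>)"
    by (simp add: add_divide_distrib)
qed

section \<open>The element of the group attached to a partition\<close>

text \<open>The comb plays the role of a base point: sending a dyadic partition to the map that takes the comb to it
turns images of partitions into left multiplication, because the image of a partition has equally many points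
and so belongs to the same comb. The subtraction of 2 accounts for the indexing of combs by their
inner points.\<close>

definition frame :: "real set \<Rightarrow> real \<Rightarrow> real" where
  "frame X = represented_map (comb (card (adapted X) - 2)) (adapted X)"

lemma represents_frame:
  assumes "finite X"
  shows "represents (comb (card (adapted X) - 2)) (adapted X) (frame X)"
  unfolding frame_def
proof (rule represents_represented_map)
  show U: "adapted X \<in> unit_partitions" by (rule adapted_unit_partition[OF assms])
  show "comb (card (adapted X) - 2) \<in> unit_partitions" by (rule dyadic_partitionsD(1)[OF comb_dyadic])
  have "card {0, 1 :: real} \<le> card (adapted X)" using unit_partitionsD[OF U] by (intro card_mono) auto
  then show "card (comb (card (adapted X) - 2)) = card (adapted X)" by (simp add: card_comb)
qed

lemma frame_in_F: "finite X \<Longrightarrow> frame X \<in> carrier thompson_F"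
  unfolding thompson_F_iff using represents_frame adapted_dyadic comb_dyadic by blast

lemma frame_equivariant:
  assumes S: "S \<in> dyadic_partitions" and T: "T \<in> dyadic_partitions" and f: "represents S T f"
    and X: "X \<in> unit_partitions" "\<And>a b. consecutive S a b \<Longrightarrow> crowded X a b"
  shows "frame (f ` X) = f \<otimes>\<^bsub>thompson_F\<^esub> frame X"
proof -
  note fin = unit_partitionsD(1)[OF X(1)]
  have fF: "f \<in> carrier thompson_F" unfolding thompson_F_iff using S T f by blast
  have eq: "adapted (f ` X) = f ` adapted X"
    by (rule adapted_image[OF S T f unit_partitionsD(2)[OF X(1)] X(2) fin])
  have f': "represents (adapted X) (adapted (f ` X)) f"
    unfolding eq
    using represents_refine[OF dyadic_partitionsD(1)[OF S] f partition_subset_adapted[OF S X(2)]]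
      unit_partitionsD(2)[OF adapted_unit_partition[OF fin]] by blast
  let ?C = "comb (card (adapted X) - 2)"
  have C: "?C \<in> unit_partitions" by (rule dyadic_partitionsD(1)[OF comb_dyadic])
  have "represents ?C (adapted (f ` X)) (compose {0..1} f (frame X))"
    using represents_frame[OF fin] f' unit_partitionsD(2)[OF C] by (rule represents_compose)
  moreover have "represents ?C (adapted (f ` X)) (frame (f ` X))"
    using represents_frame[of "f ` X"] represents_card[OF f'] fin by simp
  ultimately have "frame (f ` X) = compose {0..1} f (frame X)"
    by (rule represents_unique[OF C, rotated])
  then show ?thesis using thompson_F_mult[OF frame_in_F[OF fin] fF] by simp
qed

text \<open>The intervals of the comb on which \<open>x\<^sub>0\<close> or \<open>x\<^sub>1\<close> is affine have length at least \<open>1/8\<close>, hence at least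
twice the mesh.\<close>

lemma generator_equivariant:
  assumes X: "X \<in> unit_partitions" "mesh X \<le> 1 / 16" and f: "f \<in> {thompson_x0, thompson_x1}"
  shows "frame (f ` X) = f \<otimes>\<^bsub>thompson_F\<^esub> frame X"
proof -
  obtain j where j: "j \<le> 1" "f = comb_shift j"
    using f by (auto simp: thompson_x0_eq thompson_x1_eq)
  have crowd: "crowded X a b" if ab: "consecutive (comb (Suc (Suc j))) a b" for a b
  proof -
    obtain i where i: "i \<le> Suc (Suc j)" "a = 1 - 1 / 2 ^ i"
      "b = (if i = Suc (Suc j) then 1 else 1 - 1 / 2 ^ Suc i)"
      using consecutive_comb[OF ab] .
    have "i \<le> 3" "i = 3 \<longrightarrow> b = 1" using i(1,3) j(1) by auto
    then have "1 / 8 \<le> b - a" "0 \<le> a" "b \<le> 1"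
      using i by (auto simp: le_Suc_eq numeral_3_eq_3)
    then show ?thesis using crowded_of_mesh[OF X(1), of a b] X(2) by simp
  qed
  show ?thesis unfolding j(2)
    by (rule frame_equivariant[OF comb_dyadic _ represents_comb_shift_comb[OF lessI] X(1) crowd])
      (rule insert_midpoint_dyadic[OF comb_dyadic comb_interval_consecutive[OF lessI]])
qed

theorem proposition2p1:
  assumes "\<And>\<epsilon>::real. \<epsilon> > 0 \<Longrightarrow>
    \<exists>\<A>. finite \<A> \<and> \<A> \<subseteq> unit_partitions \<and>
        (\<forall>x \<in> {thompson_x0, thompson_x1}.
           real (card (sym_diff \<A> (translate \<A> x))) < \<epsilon> * real (card \<A>)) \<and>
        (\<forall>X \<in> \<A>. mesh X \<le> 1/16)"
  shows "amenable thompson_F"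
proof (rule amenable_if_almost_invariant[OF group_thompson_F generators_in_F thompson_F_generated])
  interpret group thompson_F by (rule group_thompson_F)
  fix \<epsilon> :: real assume "0 < \<epsilon>"
  then obtain \<A> where \<A>: "finite \<A>" "\<A> \<subseteq> unit_partitions" "\<forall>X \<in> \<A>. mesh X \<le> 1/16"
    and small: "\<And>x. x \<in> {thompson_x0, thompson_x1} \<Longrightarrow>
      real (card (sym_diff \<A> (translate \<A> x))) < \<epsilon> * real (card \<A>)"
    using assms by meson
  have "\<A> \<noteq> {}" using small[of thompson_x0] by auto
  then have pos: "0 < real (card \<A>)" using \<A>(1) by (simp add: card_gt_0_iff)
  define \<nu> where "\<nu> = (\<lambda>E. real (card (\<A> \<inter> frame -` E)) / real (card \<A>))"
  have "frame ` \<A> \<subseteq> carrier thompson_F"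
    using \<A>(2) frame_in_F unit_partitionsD(1) by blast
  then have \<nu>: "additive_probability thompson_F \<nu>"
    unfolding \<nu>_def by (rule uniform_pushforward[OF \<A>(1) \<open>\<A> \<noteq> {}\<close>])
  have "\<bar>\<nu> (g <#\<^bsub>thompson_F\<^esub> E) - \<nu> E\<bar> \<le> \<epsilon>"
    if g: "g \<in> {thompson_x0, thompson_x1}" and E: "E \<subseteq> carrier thompson_F" for g E
  proof -
    let ?gE = "g <#\<^bsub>thompson_F\<^esub> E"
    have gF: "g \<in> carrier thompson_F" using g generators_in_F by blast
    have tr: "translate \<A> g = (`) g ` \<A>" unfolding translate_def by blast
    have inj: "inj_on ((`) g) \<A>"
    proof (rule inj_on_subset[OF inj_on_image_Pow])
      show "inj_on g {0..1}" using thompson_F_Bij[OF gF] by (simp add: Bij_def bij_betw_def)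
      show "\<A> \<subseteq> Pow {0..1}" using \<A>(2) unit_partitionsD(2) by blast
    qed
    have mem: "frame (g ` X) \<in> ?gE \<longleftrightarrow> frame X \<in> E" if "X \<in> \<A>" for X
    proof -
      have X: "X \<in> unit_partitions" "mesh X \<le> 1/16" using that \<A> by auto
      note FX = frame_in_F[OF unit_partitionsD(1)[OF X(1)]]
      have "frame (g ` X) = g \<otimes>\<^bsub>thompson_F\<^esub> frame X" by (rule generator_equivariant[OF X g])
      then show ?thesis using E gF FX Units_l_cancel[of g "frame X"] unfolding l_coset_def by auto
    qed
    \<comment> \<open>By equivariance the sets counted by the translated measure on \<open>gE\<close> are the images of those counted by the
      original measure on \<open>E\<close>, so the defect comes only from the symmetric difference.\<close>
    have "translate \<A> g \<inter> frame -` ?gE = (`) g ` (\<A> \<inter> frame -` E)"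
      unfolding tr using mem by blast
    then have "card (translate \<A> g \<inter> frame -` ?gE) = card (\<A> \<inter> frame -` E)"
      using card_image[OF inj_on_subset[OF inj Int_lower1]] by simp
    then have "\<bar>real (card (\<A> \<inter> frame -` ?gE)) - real (card (\<A> \<inter> frame -` E))\<bar>
        \<le> real (card (sym_diff \<A> (translate \<A> g)))"
      using card_Int_diff_le[OF \<A>(1), of "translate \<A> g" "frame -` ?gE"] \<A>(1) by (simp add: tr)
    also have "\<dots> \<le> \<epsilon> * real (card \<A>)" using small[OF g] by simp
    finally have "\<bar>real (card (\<A> \<inter> frame -` ?gE)) - real (card (\<A> \<inter> frame -` E))\<bar> / real (card \<A>) \<le> \<epsilon>"
      using pos by (simp add: pos_divide_le_eq)
    then show ?thesis using pos by (simp add: \<nu>_def diff_divide_distrib[symmetric] abs_divide)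
  qed
  then show "\<exists>\<nu>. additive_probability thompson_F \<nu> \<and>
      (\<forall>g\<in>{thompson_x0, thompson_x1}. \<forall>A\<subseteq>carrier thompson_F.
        \<bar>\<nu> (g <#\<^bsub>thompson_F\<^esub> A) - \<nu> A\<bar> \<le> \<epsilon>)"
    using \<nu> by blast
qed

end
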